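(* For every integer $n\ge 1$, $$\mathcal{S}_{n}=\mathcal{D}_{n}=\beta'(-n)+(\log 4)\,\beta(-n),$$ where $$\mathcal{S}_{n}=\sum_{k=0}^{n}T(n,k)\left[\log\Gamma_{n+1}\!\Big(\frac{4(n-k)+1}{4}\Big)-\log\Gamma_{n+1}\!\Big(\frac{4k+3}{4}\Big)\right]$$ and $$\mathcal{D}_{n}=4^{n}\sum_{\ell=1}^{n+1}\Big[P_{n+1,\ell}\!\Big(\tfrac14\Big)\log\Gamma_{\ell}\!\Big(\tfrac14\Big)-P_{n+1,\ell}\!\Big(\tfrac34\Big)\log\Gamma_{\ell}\!\Big(\tfrac34\Big)\Big].$$
   Context: Dirichlet beta function: $\beta(s)=\sum_{m=0}^{\infty}(-1)^m(2m+1)^{-s}$ for $\Re s>0$, extended to an entire function of $s$ by analytic continuation; equivalently $\beta(s)=4^{-s}\big(\zeta(s,1/4)-\zeta(s,3/4)\big)$ with $\zeta(s,a)$ the Hurwitz zeta function. $\beta'$ is its derivative. Generalised Eulerian weights: integers $T(n,k)$ with $T(0,0)=1$, $T(n,k)=0$ for $k<0$ or $k>n$, and for $n\ge 0$, $0\le k\le n+1$, $$T(n+1,k)=\big(4(n-k)+5\big)T(n,k-1)+(4k+3)T(n,k).$$ Polynomials: for integers $k,\ell\ge 1$, $P_{k,\ell}(x)=\sum_{j=1}^{\ell}\binom{\ell-1}{j-1}(-1)^{j+k}(j-x)^{k-1}$. Multiple gamma functions (Vignéras): $\Gamma_m$, $m\ge 1$, are meromorphic functions on $\mathbb{C}$,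 positive on $(0,\infty)$, without zeros and with poles exactly at the non-positive integers, determined by $\Gamma_1=\Gamma$, $\Gamma_{m}(1)=1$, $\Gamma_{m+1}(z+1)=\Gamma_{m+1}(z)/\Gamma_m(z)$, together with the log-convexity condition $(-1)^{m+1}\frac{d^{m+1}}{dx^{m+1}}\log\Gamma_m(x)\ge 0$ for $x>0$. In particular $\Gamma_2=1/G$ with $G$ the Barnes $G$-function. $\log\Gamma_m(x)$ for $x>0$ is the real logarithm. *)

theory Defs
  imports "HOL-Complex_Analysis.Complex_Analysis"
begin

text \<open>The series converges only conditionally for \<open>0 < Re s \<le> 1\<close>, hence \<open>sums\<close>. The entire
  continuation is unique by the identity theorem.\<close>

definition dirichlet_beta :: "complex \<Rightarrow> complex" where
  "dirichlet_beta = (THE f. f holomorphic_on UNIV \<and>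
     (\<forall>s. Re s > 0 \<longrightarrow> (\<lambda>m. (-1) ^ m * of_nat (2 * m + 1) powr (- s)) sums f s))"

primrec gen_euler_T :: "nat \<Rightarrow> int \<Rightarrow> int" where
  "gen_euler_T 0 k = (if k = 0 then 1 else 0)"
| "gen_euler_T (Suc n) k =
     (if 0 \<le> k \<and> k \<le> int n + 1
      then (4 * (int n - k) + 5) * gen_euler_T n (k - 1) + (4 * k + 3) * gen_euler_T n k
      else 0)"

text \<open>Only meaningful for \<open>k, l \<ge> 1\<close>.\<close>

definition P_poly :: "nat \<Rightarrow> nat \<Rightarrow> real \<Rightarrow> real" where
  "P_poly k l x =
     (\<Sum>j=1..l. of_nat ((l - 1) choose (j - 1)) * (-1) ^ (j + k) * (of_nat j - x) ^ (k - 1))"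

definition log_gamma_real :: "(nat \<Rightarrow> complex \<Rightarrow> complex) \<Rightarrow> nat \<Rightarrow> real \<Rightarrow> real" where
  "log_gamma_real Gam m x = ln (Re (Gam m (of_real x)))"

text \<open>The conditions characterising the Vigneras multiple gamma functions \<open>Gam m\<close>, \<open>m \<ge> 1\<close>. They
  determine \<open>Gam m\<close> off its poles; for \<open>m \<ge> 2\<close> the values assigned at the poles
  themselves are left arbitrary, and \<open>Gam 0\<close> is unconstrained. The functional equation is one
  between meromorphic functions, so it is imposed away from the poles only.\<close>

definition multiple_gamma_functions :: "(nat \<Rightarrow> complex \<Rightarrow> complex) \<Rightarrow> bool" where
  "multiple_gamma_functions Gam \<longleftrightarrow>
     Gam 1 = Gamma \<and>
     (\<forall>m\<ge>1.
        Gam m meromorphic_on UNIV \<and>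
        Gam m analytic_on - \<int>\<^sub>\<le>\<^sub>0 \<and>
        (\<forall>z\<in>\<int>\<^sub>\<le>\<^sub>0. is_pole (Gam m) z) \<and>
        (\<forall>z. z \<notin> \<int>\<^sub>\<le>\<^sub>0 \<longrightarrow> Gam m z \<noteq> 0) \<and>
        (\<forall>x::real. x > 0 \<longrightarrow> Gam m (of_real x) \<in> \<real> \<and> Re (Gam m (of_real x)) > 0) \<and>
        Gam m 1 = 1 \<and>
        (\<forall>z. z \<notin> \<int>\<^sub>\<le>\<^sub>0 \<longrightarrow> Gam (m + 1) (z + 1) = Gam (m + 1) z / Gam m z) \<and>
        (\<forall>x::real. x > 0 \<longrightarrow>
           (-1) ^ (m + 1) * (deriv ^^ (m + 1)) (log_gamma_real Gam m) x \<ge> 0))"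

definition S_sum :: "(nat \<Rightarrow> complex \<Rightarrow> complex) \<Rightarrow> nat \<Rightarrow> real" where
  "S_sum Gam n =
     (\<Sum>k=0..n. of_int (gen_euler_T n (int k)) *
        (log_gamma_real Gam (n + 1) ((4 * (real n - real k) + 1) / 4)
         - log_gamma_real Gam (n + 1) ((4 * real k + 3) / 4)))"

definition D_sum :: "(nat \<Rightarrow> complex \<Rightarrow> complex) \<Rightarrow> nat \<Rightarrow> real" where
  "D_sum Gam n =
     4 ^ n * (\<Sum>l=1..n+1. P_poly (n + 1) l (1/4) * log_gamma_real Gam l (1/4)
                        - P_poly (n + 1) l (3/4) * log_gamma_real Gam l (3/4))"

end

theory Submission
  imports Defs
begin

text \<open>Write \<open>E\<close> for the shift of a sequence and \<open>\<Delta> = 1 - E\<close>. Everything is read off along the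
points \<open>x\<^sub>m = (2 m + 1) / 4\<close>, the half-integer progression through \<open>1/4\<close> and \<open>3/4\<close>.

\<^emph>\<open>The beta side.\<close> Repeated summation by parts turns \<open>\<Sum>(-1)\<^sup>m c\<^sub>m\<close> into
\<open>\<Sum>\<^sub>j\<^sub><\<^sub>N (\<Delta>\<^sup>j c)\<^sub>0 / 2\<^sup>j\<^sup>+\<^sup>1 + 2\<^sup>-\<^sup>N \<Sum>(-1)\<^sup>m (\<Delta>\<^sup>N c)\<^sub>m\<close>. For \<open>c\<^sub>m = (2 m + 1)\<^sup>-\<^sup>s\<close> the right-hand side
converges locally uniformly on \<open>Re s > 1 - N\<close>, so it is the analytic continuation of the beta
function and may be differentiated term by term. Hence \<open>\<beta>'(-n) + log 4 \<beta>(-n)\<close> is the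
regularised sum of \<open>(-1)\<^sup>m c\<^sub>m\<close> with \<open>c\<^sub>m = - 4\<^sup>n x\<^sub>m\<^sup>n log x\<^sub>m\<close>. Such a sum equals \<open>b\<^sub>0\<close> as soon
as \<open>c = b + E b\<close> and \<open>\<Delta>\<^sup>N b\<close> tends to zero (lemma \<open>euler_sum_unique\<close>).

\<^emph>\<open>The gamma side.\<close> The combination \<open>f(x) = \<Sum>\<^sub>l P\<^sub>n\<^sub>+\<^sub>1\<^sub>,\<^sub>l(x) log \<Gamma>\<^sub>l(x)\<close> satisfies
\<open>f(x + 1) - f(x) = x\<^sup>n log x\<close>, because the \<open>P\<^sub>n\<^sub>+\<^sub>1\<^sub>,\<^sub>l\<close> are iterated differences of an
\<open>n\<close>-th power. So \<open>b\<^sub>m = 4\<^sup>n (f(x\<^sub>m) - f(x\<^sub>m + 1/2))\<close> solves \<open>b + E b = c\<close>, and \<open>b\<^sub>0\<close> is \<open>D_sum\<close>.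

\<^emph>\<open>Decay.\<close> A functional equation alone leaves periodic freedom; the convexity condition on
\<open>log \<Gamma>\<^sub>l\<close> removes it. Put \<open>a\<^sub>0 = - log\<close> and \<open>a\<^sub>l = log \<Gamma>\<^sub>l\<close> along the \<open>x\<^sub>m\<close>. The mean value theorem
turns convexity into \<open>w\<^sub>l = \<Delta>\<^sup>l\<^sup>+\<^sup>1 a\<^sub>l \<ge> 0\<close>, and \<open>(1 - E\<^sup>2) a\<^sub>l = a\<^sub>l\<^sub>-\<^sub>1\<close> becomes
\<open>w\<^sub>l + E w\<^sub>l = w\<^sub>l\<^sub>-\<^sub>1\<close>. Non-negativity then gives \<open>0 \<le> \<Delta>\<^sup>j w\<^sub>l \<le> \<Delta>\<^sup>j w\<^sub>0\<close> for all \<open>j\<close> by induction on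
\<open>l\<close>, and \<open>\<Delta>\<^sup>j w\<^sub>0\<close>, a difference of the logarithm, decays like \<open>m\<^sup>-\<^sup>j\<^sup>-\<^sup>1\<close>. This is strong enough
to survive multiplication by the polynomials \<open>P\<^sub>n\<^sub>+\<^sub>1\<^sub>,\<^sub>l\<close> (lemma \<open>tame_gamma_combination\<close>).

\<^emph>\<open>The Eulerian side.\<close> The functional equation writes \<open>log \<Gamma>\<^sub>n\<^sub>+\<^sub>1(x + k)\<close> for \<open>k \<le> n\<close> as a
binomial combination of the \<open>log \<Gamma>\<^sub>l(x)\<close>. Thus \<open>S_sum = D_sum\<close> reduces to evaluating
\<open>\<Sum>\<^sub>k T(n,k) (k choose i)\<close> and its mirror image as iterated differences of \<open>(4 j + 1)\<^sup>n\<close> and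
\<open>(4 j + 3)\<^sup>n\<close>, which holds since both sides obey the same recurrence.\<close>

section \<open>Iterated differences\<close>

text \<open>The sign is opposite to the usual forward difference, so that the iterated differences of a
completely monotone sequence are non-negative.\<close>

definition fdiff :: "(nat \<Rightarrow> 'a::ab_group_add) \<Rightarrow> nat \<Rightarrow> 'a" where
  "fdiff c m = c m - c (Suc m)"

lemma fdiff_pow_Suc: "(fdiff ^^ Suc N) c m = (fdiff ^^ N) c m - (fdiff ^^ N) c (Suc m)"
  by (simp add: fdiff_def)

lemma fdiff_pow_shift: "(fdiff ^^ N) (\<lambda>m. c (Suc m)) m = (fdiff ^^ N) c (Suc m)"
  by (induction N arbitrary: m) (simp_all add: fdiff_def)

lemma fdiff_pow_add: "(fdiff ^^ N) (\<lambda>m. b m + c m) m = (fdiff ^^ N) b m + (fdiff ^^ N) c m"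
  by (induction N arbitrary: m) (simp_all add: fdiff_def)

lemma fdiff_pow_diff: "(fdiff ^^ N) (\<lambda>m. b m - c m) m = (fdiff ^^ N) b m - (fdiff ^^ N) c m"
  by (induction N arbitrary: m) (simp_all add: fdiff_def)

lemma fdiff_pow_cmult:
  fixes c :: "nat \<Rightarrow> 'a::comm_ring_1"
  shows "(fdiff ^^ N) (\<lambda>m. k * c m) m = k * (fdiff ^^ N) c m"
  by (induction N arbitrary: m) (simp_all add: fdiff_def algebra_simps)

lemma fdiff_pow_of_real:
  "(fdiff ^^ N) (\<lambda>m. of_real (c m) :: 'a::real_normed_field) m = of_real ((fdiff ^^ N) c m)"
  by (induction N arbitrary: m) (simp_all add: fdiff_def)

text \<open>The Leibniz rule has only two terms here because the second difference of an affine sequence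
vanishes. Both the vanishing of high differences of powers and all recurrences below come from it.\<close>

lemma fdiff_pow_affine_mult:
  fixes b :: "nat \<Rightarrow> 'a::comm_ring_1"
  shows "(fdiff ^^ N) (\<lambda>m. (p + q * of_nat m) * b m) m =
    (p + q * of_nat m) * (fdiff ^^ N) b m - q * of_nat N * (fdiff ^^ (N - 1)) b (Suc m)"
proof (induction N arbitrary: m)
  case (Suc N)
  show ?case
  proof (cases N)
    case (Suc k)
    show ?thesis
      unfolding fdiff_pow_Suc[of N] Suc.IH unfolding Suc diff_Suc_1
      by (simp only: fdiff_pow_Suc of_nat_Suc) (simp add: algebra_simps)
  qed (simp add: fdiff_def algebra_simps)
qed simp

lemma fdiff_pow_affine_power_eq_0:
  fixes p q :: "'a::comm_ring_1"
  assumes "N > n"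
  shows "(fdiff ^^ N) (\<lambda>m. (p + q * of_nat m) ^ n) m = 0"
  using assms
proof (induction n arbitrary: N m)
  case 0
  have "(fdiff ^^ Suc k) (\<lambda>m. 1 :: 'a) m = 0" for k m
    by (induction k arbitrary: m) (simp_all add: fdiff_def)
  from this[of "N - 1" m] 0 show ?case by simp
next
  case (Suc n)
  then show ?case
    by (simp only: power_Suc fdiff_pow_affine_mult) (simp add: Suc.IH)
qed

lemma fdiff_pow_binomial:
  fixes c :: "nat \<Rightarrow> 'a::comm_ring_1"
  shows "(fdiff ^^ r) c m = (\<Sum>i\<le>r. (-1) ^ i * of_nat (r choose i) * c (m + i))"
proof (induction r arbitrary: m)
  case (Suc r)
  have "(\<Sum>i\<le>Suc r. (-1) ^ i * of_nat (Suc r choose i) * c (m + i)) =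
      c m - (\<Sum>i\<le>r. (-1) ^ i * of_nat (Suc r choose Suc i) * c (Suc m + i))"
    by (subst sum.atMost_Suc_shift) (simp add: sum_negf)
  also have "\<dots> = (c m - (\<Sum>i\<le>r. (-1) ^ i * of_nat (r choose Suc i) * c (Suc m + i)))
      - (\<Sum>i\<le>r. (-1) ^ i * of_nat (r choose i) * c (Suc m + i))"
    by (simp add: algebra_simps sum.distrib)
  also have "c m - (\<Sum>i\<le>r. (-1) ^ i * of_nat (r choose Suc i) * c (Suc m + i)) =
      (\<Sum>i\<le>Suc r. (-1) ^ i * of_nat (r choose i) * c (m + i))"
    by (subst sum.atMost_Suc_shift) (simp add: sum_negf)
  also have "\<dots> = (\<Sum>i\<le>r. (-1) ^ i * of_nat (r choose i) * c (m + i))"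
    by (simp add: binomial_eq_0)
  finally show ?case by (simp only: fdiff_pow_Suc Suc)
qed simp

lemma fdiff_pow_from_0:
  fixes c :: "nat \<Rightarrow> 'a::comm_ring_1"
  shows "(fdiff ^^ N) (\<lambda>i. c (m + i)) 0 = (fdiff ^^ N) c m"
  unfolding fdiff_pow_binomial by simp

lemma fdiff_pow_tendsto_0:
  fixes c :: "nat \<Rightarrow> 'a::real_normed_vector"
  assumes "c \<longlonglongrightarrow> 0"
  shows "(fdiff ^^ N) c \<longlonglongrightarrow> 0"
proof (induction N)
  case (Suc N)
  from tendsto_diff[OF this LIMSEQ_Suc[OF this]] show ?case
    by (simp add: fdiff_def[abs_def])
qed (simp add: assms)

lemma fdiff_pow_funpow_add: "(fdiff ^^ j) ((fdiff ^^ k) c) = (fdiff ^^ (j + k)) c"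
  by (simp add: funpow_add)

lemma fdiff_pow_real_step:
  "(fdiff ^^ N) (\<lambda>m. f (x + h * real m)) (Suc m) = (fdiff ^^ N) (\<lambda>m. f ((x + h) + h * real m)) m"
  using fdiff_pow_shift[of N "\<lambda>m. f (x + h * real m)" m] by (simp add: algebra_simps)

text \<open>Each difference step costs one derivative: the mean value theorem is applied to
\<open>x \<mapsto> \<Delta>\<^sup>k f(x)\<close>, whose derivative is \<open>\<Delta>\<^sup>k f'(x)\<close>. Indexing the derivatives as a family \<open>F i\<close> lets
the induction pass from \<open>F i\<close> to \<open>F (Suc i)\<close>.\<close>

lemma fdiff_pow_mean_value:
  fixes F :: "nat \<Rightarrow> real \<Rightarrow> real"
  assumes der: "\<And>i t. t > 0 \<Longrightarrow> (F i has_real_derivative F (Suc i) t) (at t)"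
    and "h > 0" "x > 0"
  shows "\<exists>\<xi>\<ge>x. (fdiff ^^ k) (\<lambda>m. F i (x + h * real m)) 0 = (- h) ^ k * F (i + k) \<xi>"
  using \<open>x > 0\<close>
proof (induction k arbitrary: i x)
  case 0
  then show ?case by auto
next
  case (Suc k)
  let ?G = "\<lambda>i y. (fdiff ^^ k) (\<lambda>m. F i (y + h * real m)) 0"
  have G: "((\<lambda>y. (fdiff ^^ k) (\<lambda>m. F i (y + h * real m)) l)
      has_real_derivative (fdiff ^^ k) (\<lambda>m. F (Suc i) (y + h * real m)) l) (at y)"
    if "y > 0" for y l k
    using that
  proof (induction k arbitrary: l)
    case 0
    have "0 < y + h * real l" using 0 \<open>h > 0\<close> by (simp add: add_pos_nonneg)
    have "((\<lambda>y. y + h * real l) has_real_derivative 1) (at y)"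
      by (auto intro!: derivative_eq_intros)
    from DERIV_chain2[where f = "F i", OF der[OF \<open>0 < y + h * real l\<close>] this]
    show ?case by simp
  next
    case (Suc k)
    then show ?case unfolding fdiff_pow_Suc by (intro DERIV_diff) auto
  qed
  have "\<exists>z. x < z \<and> z < x + h \<and> ?G i (x + h) - ?G i x = (x + h - x) * ?G (Suc i) z"
    using \<open>x > 0\<close> \<open>h > 0\<close> by (intro MVT2 G) auto
  then obtain z where z: "x < z" "?G i (x + h) - ?G i x = h * ?G (Suc i) z"
    by auto
  obtain \<xi> where "\<xi> \<ge> z" "?G (Suc i) z = (- h) ^ k * F (Suc i + k) \<xi>"
    using Suc.IH[of z "Suc i"] z(1) \<open>x > 0\<close> by auto
  moreover have "(fdiff ^^ Suc k) (\<lambda>m. F i (x + h * real m)) 0 = ?G i x - ?G i (x + h)"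
    unfolding fdiff_pow_Suc fdiff_pow_real_step ..
  ultimately show ?case using z by (intro exI[of _ \<xi>]) auto
qed

text \<open>For vector-valued functions no intermediate point exists, but the norm estimate survives.\<close>

lemma norm_fdiff_pow_le:
  fixes F :: "nat \<Rightarrow> real \<Rightarrow> 'a::real_normed_vector"
  assumes der: "\<And>i t. t > 0 \<Longrightarrow> (F i has_vector_derivative F (Suc i) t) (at t)"
    and "h > 0" "x > 0" and bd: "\<And>t. t \<ge> x \<Longrightarrow> norm (F (i + k) t) \<le> B"
  shows "norm ((fdiff ^^ k) (\<lambda>m. F i (x + h * real m)) 0) \<le> h ^ k * B"
  using \<open>x > 0\<close> bd
proof (induction k arbitrary: i x)
  case 0
  then show ?case by auto
next
  case (Suc k)
  let ?G = "\<lambda>i y. (fdiff ^^ k) (\<lambda>m. F i (y + h * real m)) 0"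
  have G: "((\<lambda>y. (fdiff ^^ k) (\<lambda>m. F i (y + h * real m)) l)
      has_vector_derivative (fdiff ^^ k) (\<lambda>m. F (Suc i) (y + h * real m)) l) (at y)"
    if "y > 0" for y l k
    using that
  proof (induction k arbitrary: l)
    case 0
    have "0 < y + h * real l" using 0 \<open>h > 0\<close> by (simp add: add_pos_nonneg)
    have "((\<lambda>y. y + h * real l) has_vector_derivative 1) (at y)"
      by (auto intro!: derivative_eq_intros)
    from vector_diff_chain_at[where g = "F i", OF this der[OF \<open>0 < y + h * real l\<close>]]
    show ?case by (simp add: o_def)
  next
    case (Suc k)
    then show ?case unfolding fdiff_pow_Suc by (intro has_vector_derivative_diff) auto
  qed
  have "norm (?G i (x + h) - ?G i x) \<le> h ^ k * B * norm (x + h - x)"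
  proof (rule differentiable_bound[where S = "{x..x+h}"])
    show "(?G i has_derivative (\<lambda>t. t *\<^sub>R ?G (Suc i) y)) (at y within {x..x+h})" if "y \<in> {x..x+h}" for y
      using G[of y k 0] that Suc.prems(1)
      by (auto simp: has_vector_derivative_def intro: has_derivative_at_withinI)
    show "onorm (\<lambda>t. t *\<^sub>R ?G (Suc i) y) \<le> h ^ k * B" if "y \<in> {x..x+h}" for y
    proof (rule onorm_le)
      fix t :: real
      have "norm (?G (Suc i) y) \<le> h ^ k * B"
        using that Suc.prems by (intro Suc.IH) auto
      then show "norm (t *\<^sub>R ?G (Suc i) y) \<le> h ^ k * B * norm t"
        by (simp add: mult.commute mult_left_mono)
    qed
  qed (use \<open>h > 0\<close> in auto)
  moreover have "(fdiff ^^ Suc k) (\<lambda>m. F i (x + h * real m)) 0 = ?G i x - ?G i (x + h)"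
    unfolding fdiff_pow_Suc fdiff_pow_real_step ..
  ultimately show ?case using \<open>h > 0\<close> by (simp add: norm_minus_commute[of "?G i x"] mult_ac del: funpow.simps)
qed

section \<open>The Euler transform of alternating series\<close>

text \<open>For a null sequence with convergent alternating series this is the value of the series, whatever
\<open>N\<close> is; for growing sequences it is a regularised value, once \<open>N\<close> is large enough.\<close>

definition euler_sum :: "nat \<Rightarrow> (nat \<Rightarrow> 'a::real_normed_field) \<Rightarrow> 'a" where
  "euler_sum N c =
     (\<Sum>j<N. (fdiff ^^ j) c 0 / 2 ^ Suc j) + (\<Sum>m. (-1) ^ m * (fdiff ^^ N) c m) / 2 ^ N"

lemma alternating_sums_euler_step:
  fixes c :: "nat \<Rightarrow> 'a::real_normed_field"
  assumes "c \<longlonglongrightarrow> 0" and "(\<lambda>m. (-1) ^ m * fdiff c m) sums L"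
  shows "(\<lambda>m. (-1) ^ m * c m) sums ((c 0 + L) / 2)"
proof -
  have "2 * (\<Sum>m<M. (-1) ^ m * c m) =
      c 0 + (\<Sum>m<M. (-1) ^ m * fdiff c m) - (-1) ^ M * c M" for M
    by (induction M) (auto simp: fdiff_def algebra_simps)
  then have part: "(\<Sum>m<M. (-1) ^ m * c m) =
      (c 0 + (\<Sum>m<M. (-1) ^ m * fdiff c m) - (-1) ^ M * c M) / 2" for M
    by (metis nonzero_mult_div_cancel_left zero_neq_numeral)
  have "(\<lambda>M. (-1) ^ M * c M) \<longlonglongrightarrow> 0"
    using assms(1) by - (rule tendsto_norm_zero_cancel, simp add: norm_mult norm_power tendsto_norm_zero)
  then have "(\<lambda>M. (c 0 + (\<Sum>m<M. (-1) ^ m * fdiff c m) - (-1) ^ M * c M) / 2)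
      \<longlonglongrightarrow> (c 0 + L - 0) / 2"
    using assms(2) unfolding sums_def by (intro tendsto_intros) auto
  then show ?thesis unfolding sums_def part by simp
qed

text \<open>Independence of \<open>N\<close>: this is what glues the continuations to different half-planes together.\<close>

lemma euler_sum_extend:
  fixes c :: "nat \<Rightarrow> 'a::real_normed_field"
  assumes "(fdiff ^^ N) c \<longlonglongrightarrow> 0" and "summable (\<lambda>m. (-1) ^ m * (fdiff ^^ (N + k)) c m)"
  shows "summable (\<lambda>m. (-1) ^ m * (fdiff ^^ N) c m) \<and> euler_sum N c = euler_sum (N + k) c"
  using assms
proof (induction k arbitrary: N)
  case (Suc k)
  have "(fdiff ^^ Suc N) c \<longlonglongrightarrow> 0"
    using fdiff_pow_tendsto_0[OF Suc.prems(1), of 1] by (simp add: funpow_swap1)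
  then have "summable (\<lambda>m. (-1) ^ m * fdiff ((fdiff ^^ N) c) m)"
    and eq: "euler_sum (Suc N) c = euler_sum (N + Suc k) c"
    using Suc.IH[of "Suc N"] Suc.prems(2) by simp_all
  from alternating_sums_euler_step[OF Suc.prems(1) summable_sums[OF this(1)]]
  have s: "(\<lambda>m. (-1) ^ m * (fdiff ^^ N) c m) sums
      (((fdiff ^^ N) c 0 + (\<Sum>m. (-1) ^ m * (fdiff ^^ Suc N) c m)) / 2)" by simp
  then have "euler_sum N c = euler_sum (Suc N) c"
    unfolding euler_sum_def sums_unique[OF s, symmetric] by (simp add: field_simps)
  with s eq show ?case by (simp add: sums_iff)
qed simp

text \<open>Formally \<open>\<Sum>(-1)\<^sup>m (b\<^sub>m + b\<^sub>m\<^sub>+\<^sub>1)\<close> telescopes to \<open>b\<^sub>0\<close>. The head of the transform telescopes because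
\<open>b + E b = 2 b - \<Delta> b\<close>, and the remaining series telescopes because \<open>\<Delta>\<^sup>N b\<close> tends to zero.\<close>

lemma euler_sum_unique:
  fixes b c :: "nat \<Rightarrow> 'a::real_normed_field"
  assumes bc: "\<And>m. b m + b (Suc m) = c m" and lim: "(fdiff ^^ N) b \<longlonglongrightarrow> 0"
  shows "euler_sum N c = b 0"
proof -
  have D: "(fdiff ^^ k) c m = (fdiff ^^ k) b m + (fdiff ^^ k) b (Suc m)" for k m
  proof -
    have "c = (\<lambda>m. b m + b (Suc m))" using bc by auto
    then show ?thesis by (simp only: fdiff_pow_add fdiff_pow_shift)
  qed
  have "(\<Sum>m<M. (-1) ^ m * (fdiff ^^ N) c m) = (fdiff ^^ N) b 0 - (-1) ^ M * (fdiff ^^ N) b M" for M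
    by (induction M) (auto simp: D algebra_simps)
  moreover have "(\<lambda>M. (-1) ^ M * (fdiff ^^ N) b M) \<longlonglongrightarrow> 0"
    using lim by - (rule tendsto_norm_zero_cancel, simp add: norm_mult norm_power tendsto_norm_zero)
  then have "(\<lambda>M. (fdiff ^^ N) b 0 - (-1) ^ M * (fdiff ^^ N) b M) \<longlonglongrightarrow> (fdiff ^^ N) b 0 - 0"
    by (intro tendsto_intros)
  ultimately have "(\<lambda>m. (-1) ^ m * (fdiff ^^ N) c m) sums (fdiff ^^ N) b 0"
    by (simp add: sums_def)
  note s = sums_unique[OF this]
  have "(\<Sum>j<k. (fdiff ^^ j) c 0 / 2 ^ Suc j) = b 0 - (fdiff ^^ k) b 0 / 2 ^ k" for k
  proof (induction k)
    case (Suc k)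
    show ?case unfolding sum.lessThan_Suc Suc.IH unfolding D fdiff_pow_Suc by (simp add: field_simps)
  qed simp
  then show ?thesis unfolding euler_sum_def s[symmetric] by simp
qed

lemma euler_sum_add:
  assumes "summable (\<lambda>m. (-1) ^ m * (fdiff ^^ N) b m)" "summable (\<lambda>m. (-1) ^ m * (fdiff ^^ N) c m)"
  shows "euler_sum N (\<lambda>m. b m + c m) = euler_sum N b + euler_sum N c"
proof -
  have "(\<Sum>m. (-1) ^ m * (fdiff ^^ N) (\<lambda>m. b m + c m) m) =
      (\<Sum>m. (-1) ^ m * (fdiff ^^ N) b m) + (\<Sum>m. (-1) ^ m * (fdiff ^^ N) c m)"
    unfolding fdiff_pow_add distrib_left by (rule suminf_add[OF assms, symmetric])
  then show ?thesis
    unfolding euler_sum_def fdiff_pow_add by (simp add: sum.distrib add_divide_distrib)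
qed

lemma euler_sum_cmult:
  assumes "summable (\<lambda>m. (-1) ^ m * (fdiff ^^ N) c m)"
  shows "euler_sum N (\<lambda>m. k * c m) = k * euler_sum N c"
proof -
  have "(\<Sum>m. (-1) ^ m * (fdiff ^^ N) (\<lambda>m. k * c m) m) = k * (\<Sum>m. (-1) ^ m * (fdiff ^^ N) c m)"
    unfolding fdiff_pow_cmult mult.left_commute[of _ k] by (rule suminf_mult[OF assms])
  then show ?thesis
    unfolding euler_sum_def fdiff_pow_cmult by (simp add: sum_distrib_left distrib_left)
qed

section \<open>Analytic continuation of the Dirichlet beta function\<close>

definition beta_coeff :: "complex \<Rightarrow> nat \<Rightarrow> complex" where
  "beta_coeff s m = of_nat (2 * m + 1) powr (- s)"

lemma norm_pochhammer_le: "norm (pochhammer s N) \<le> (norm s + real N) ^ N" for s :: complex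
proof -
  have "norm (pochhammer s N) = (\<Prod>i<N. norm (s + of_nat i))"
    by (simp add: pochhammer_prod prod_norm atLeast0LessThan)
  also have "\<dots> \<le> (\<Prod>i<N. norm s + real N)"
  proof (intro prod_mono conjI)
    fix i assume "i \<in> {..<N}"
    have "norm (s + of_nat i) \<le> norm s + norm (of_nat i :: complex)"
      by (rule norm_triangle_ineq)
    with \<open>i \<in> {..<N}\<close> show "norm (s + of_nat i) \<le> norm s + real N" by simp
  qed auto
  finally show ?thesis by simp
qed

text \<open>The \<open>N\<close>-th derivative of \<open>t\<^sup>-\<^sup>s\<close> is \<open>\<plusminus> s (s + 1) \<dots> (s + N - 1) t\<^sup>-\<^sup>s\<^sup>-\<^sup>N\<close>: every difference gains one power
of \<open>m\<close>, which is what moves the half-plane of convergence to the left.\<close>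

lemma norm_fdiff_pow_beta_coeff_le:
  assumes "Re s + real N \<ge> 0"
  shows "norm ((fdiff ^^ N) (beta_coeff s) m)
    \<le> (2 * (norm s + real N)) ^ N * real (2 * m + 1) powr - (Re s + real N)"
proof -
  define F where
    "F i t = (-1) ^ i * pochhammer s i * of_real t powr (- s - of_nat i)" for i and t :: real
  have der: "(F i has_vector_derivative F (Suc i) t) (at t)" if "t > 0" for i t
  proof -
    have "((\<lambda>z. (-1) ^ i * pochhammer s i * z powr (- s - of_nat i)) has_field_derivative
        (-1) ^ i * pochhammer s i * ((- s - of_nat i) * of_real t powr (- s - of_nat i - 1)))
        (at (of_real t))"
      using that by (intro DERIV_cmult has_field_derivative_powr) (auto simp: complex_nonpos_Reals_iff)
    from has_vector_derivative_real_field[OF this] show ?thesis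
      by (simp add: F_def[abs_def] pochhammer_Suc algebra_simps)
  qed
  define x where "x = real (2 * m + 1)"
  have "x > 0" by (simp add: x_def)
  have "norm ((fdiff ^^ N) (\<lambda>m. F 0 (x + 2 * real m)) 0)
      \<le> 2 ^ N * ((norm s + real N) ^ N * x powr - (Re s + real N))"
  proof (rule norm_fdiff_pow_le[where F = F, OF der])
    fix t assume "x \<le> t"
    have "norm (F (0 + N) t) = norm (pochhammer s N) * t powr - (Re s + real N)"
      using \<open>x \<le> t\<close> \<open>x > 0\<close> by (simp add: F_def norm_mult norm_power norm_powr_real_powr algebra_simps)
    also have "\<dots> \<le> (norm s + real N) ^ N * x powr - (Re s + real N)"
      using assms \<open>x \<le> t\<close> \<open>x > 0\<close>
      by (intro mult_mono norm_pochhammer_le powr_mono2') auto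
    finally show "norm (F (0 + N) t) \<le> (norm s + real N) ^ N * x powr - (Re s + real N)" .
  qed (use \<open>x > 0\<close> in auto)
  moreover have "(fdiff ^^ N) (\<lambda>i. F 0 (x + 2 * real i)) 0 = (fdiff ^^ N) (beta_coeff s) m"
    using fdiff_pow_from_0[of N "beta_coeff s" m]
    by (simp add: F_def x_def beta_coeff_def algebra_simps)
  ultimately show ?thesis by (simp only: x_def power_mult_distrib mult.assoc)
qed

lemma summable_odd_powr:
  assumes "p > 1"
  shows "summable (\<lambda>m. real (2 * m + 1) powr - p)"
proof (rule summable_comparison_test')
  show "summable (\<lambda>m. real (Suc m) powr - p)"
    using assms by (simp only: summable_Suc_iff[of "\<lambda>m. real m powr - p"] summable_real_powr_iff)
  show "norm (real (2 * m + 1) powr - p) \<le> real (Suc m) powr - p" for m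
    using assms by (simp del: of_nat_Suc) (intro powr_mono2', auto)
qed

text \<open>The derivative of \<open>beta_coeff\<close> with respect to \<open>s\<close>.\<close>

definition beta_coeff' :: "complex \<Rightarrow> nat \<Rightarrow> complex" where
  "beta_coeff' s m = - of_real (ln (real (2 * m + 1))) * beta_coeff s m"

lemma has_field_derivative_fdiff_pow_beta_coeff:
  "((\<lambda>s. (fdiff ^^ N) (beta_coeff s) m) has_field_derivative (fdiff ^^ N) (beta_coeff' s) m) (at s)"
proof (induction N arbitrary: m)
  case 0
  have "Ln (of_nat (2 * m + 1)) = of_real (ln (real (2 * m + 1)))"
    by (subst Ln_of_real[symmetric]) auto
  moreover have "((\<lambda>s. of_nat (2 * m + 1) powr (- s)) has_field_derivative
      Ln (of_nat (2 * m + 1)) * of_nat (2 * m + 1) powr (- s) * (- 1)) (at s)"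
    by (intro DERIV_chain2[OF has_field_derivative_powr_right])
       (use of_nat_eq_0_iff[of "2 * m + 1", where ?'a = complex] in
         \<open>auto intro!: derivative_eq_intros simp del: of_nat_add of_nat_mult of_nat_Suc\<close>)
  ultimately show ?case
    by (simp add: beta_coeff_def[abs_def] beta_coeff'_def)
qed (unfold fdiff_pow_Suc, intro DERIV_diff)

text \<open>The bound on the differences is locally uniform in \<open>s\<close>, so the Weierstrass criterion yields
holomorphy and termwise differentiation at once.\<close>

lemma euler_sum_beta_coeff:
  assumes "Re s + real N > 1"
  shows summable_beta_coeff: "summable (\<lambda>m. (-1) ^ m * (fdiff ^^ N) (beta_coeff s) m)"
    and summable_beta_coeff': "summable (\<lambda>m. (-1) ^ m * (fdiff ^^ N) (beta_coeff' s) m)"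
    and has_field_derivative_euler_sum_beta_coeff:
      "((\<lambda>s. euler_sum N (beta_coeff s)) has_field_derivative euler_sum N (beta_coeff' s)) (at s)"
proof -
  define S where "S = {s. Re s > 1 - real N}"
  let ?f = "\<lambda>m s. (-1) ^ m * (fdiff ^^ N) (beta_coeff s) m"
  let ?f' = "\<lambda>m s. (-1) ^ m * (fdiff ^^ N) (beta_coeff' s) m"
  have "open S" unfolding S_def by (simp add: open_halfspace_Re_gt)
  have "\<exists>g g'. \<forall>x\<in>S. ((\<lambda>n. ?f n x) sums g x) \<and> ((\<lambda>n. ?f' n x) sums g' x) \<and>
      (g has_field_derivative g' x) (at x)"
  proof (rule series_and_derivative_comparison_complex[OF \<open>open S\<close>])
    show "((\<lambda>s. ?f m s) has_field_derivative ?f' m x) (at x)" for m x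
      by (intro DERIV_cmult has_field_derivative_fdiff_pow_beta_coeff)
  next
    fix s assume "s \<in> S"
    \<comment> \<open>On the disc of radius \<open>d\<close> the exponent stays below \<open>- p < - 1\<close>, and \<open>norm y \<le> norm s + 1\<close>.\<close>
    define d where "d = min 1 ((Re s + real N - 1) / 2)"
    define p where "p = Re s + real N - d"
    define C where "C = (2 * (norm s + 1 + real N)) ^ N"
    have "d > 0" "p > 1" using \<open>s \<in> S\<close> by (auto simp: d_def p_def S_def min_def field_simps)
    have "norm (?f m y) \<le> C * real (2 * m + 1) powr - p" if "y \<in> ball s d" for m y
    proof -
      have "norm (y - s) < d" using that by (simp add: dist_norm norm_minus_commute)
      then have y: "Re s - Re y \<le> d" "norm y \<le> norm s + 1"
        using abs_Re_le_cmod[of "y - s"] norm_triangle_sub[of y s] by (auto simp: d_def)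
      have "norm (?f m y) = norm ((fdiff ^^ N) (beta_coeff y) m)"
        by (simp add: norm_mult norm_power)
      also have "\<dots> \<le> (2 * (norm y + real N)) ^ N * real (2 * m + 1) powr - (Re y + real N)"
        using y \<open>p > 1\<close> by (intro norm_fdiff_pow_beta_coeff_le) (simp add: p_def)
      also have "\<dots> \<le> C * real (2 * m + 1) powr - p"
        unfolding C_def using y by (intro mult_mono power_mono powr_mono) (auto simp: p_def)
      finally show ?thesis .
    qed
    moreover have "C \<ge> 0" by (simp add: C_def)
    ultimately have "norm (?f m y) \<le> norm (complex_of_real (C * real (2 * m + 1) powr - p))"
      if "y \<in> ball s d" for m y
      using that by (simp only: norm_of_real) force
    moreover have "summable (\<lambda>m. complex_of_real (C * real (2 * m + 1) powr - p))"
      by (subst summable_complex_of_real) (rule summable_mult[OF summable_odd_powr[OF \<open>p > 1\<close>]])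
    ultimately show "\<exists>d (h :: nat \<Rightarrow> complex). 0 < d \<and> summable h \<and> range h \<subseteq> \<real>\<^sub>\<ge>\<^sub>0 \<and>
        (\<forall>\<^sub>F n in sequentially. \<forall>y\<in>ball s d \<inter> S. norm (?f n y) \<le> norm (h n))"
      using \<open>d > 0\<close> \<open>C \<ge> 0\<close>
      by (intro exI[of _ d] exI[of _ "\<lambda>m. complex_of_real (C * real (2 * m + 1) powr - p)"] conjI)
         (auto simp del: of_real_mult)
  qed
  then obtain g g' where
    g: "\<And>x. x \<in> S \<Longrightarrow> (\<lambda>n. ?f n x) sums g x" and
    g': "\<And>x. x \<in> S \<Longrightarrow> (\<lambda>n. ?f' n x) sums g' x" and
    dg: "\<And>x. x \<in> S \<Longrightarrow> (g has_field_derivative g' x) (at x)" by auto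
  have "s \<in> S" using assms by (simp add: S_def)
  from g[OF this] g'[OF this] show "summable (\<lambda>m. ?f m s)" "summable (\<lambda>m. ?f' m s)"
    by (auto simp: sums_iff)
  have "((\<lambda>s. \<Sum>m. ?f m s) has_field_derivative g' s) (at s)"
    using dg[OF \<open>s \<in> S\<close>] \<open>open S\<close> \<open>s \<in> S\<close>
    by (rule has_field_derivative_transform_within_open) (simp add: sums_unique[OF g])
  then show "((\<lambda>s. euler_sum N (beta_coeff s)) has_field_derivative euler_sum N (beta_coeff' s)) (at s)"
    unfolding euler_sum_def sums_unique[OF g'[OF \<open>s \<in> S\<close>], symmetric]
    by (intro DERIV_add DERIV_sum DERIV_cdivide has_field_derivative_fdiff_pow_beta_coeff)
qed

lemma euler_sum_beta_coeff_eq: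
  assumes "Re s + real N > 1" "N \<le> M"
  shows "euler_sum N (beta_coeff s) = euler_sum M (beta_coeff s)"
proof -
  have "(fdiff ^^ N) (beta_coeff s) \<longlonglongrightarrow> 0"
    using summable_LIMSEQ_zero[OF summable_beta_coeff[OF assms(1)]]
    by - (rule tendsto_norm_zero_cancel, drule tendsto_norm_zero, simp add: norm_mult norm_power)
  from euler_sum_extend[OF this, of "M - N"] summable_beta_coeff[of s M] assms
  show ?thesis by simp
qed

lemma sums_beta_coeff:
  assumes "Re s > 0" "Re s + real N > 1"
  shows "(\<lambda>m. (-1) ^ m * beta_coeff s m) sums euler_sum N (beta_coeff s)"
proof -
  have "(\<lambda>m. real (2 * m + 1) powr - Re s) \<longlonglongrightarrow> 0"
    using assms(1) by (intro tendsto_neg_powr filterlim_compose[OF filterlim_real_sequentially]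
        filterlim_subseq) (auto simp: strict_mono_def)
  then have "beta_coeff s \<longlonglongrightarrow> 0"
    by (intro tendsto_norm_zero_cancel[where f = "beta_coeff s"])
       (simp add: beta_coeff_def norm_powr_real_powr)
  from euler_sum_extend[of 0, simplified, OF this summable_beta_coeff[OF assms(2)]]
  show ?thesis by (auto simp: euler_sum_def dest: summable_sums)
qed

text \<open>The regularised sums with growing \<open>N\<close> fit together to an entire function, and the identity
theorem makes it the only one that agrees with the series on \<open>Re s > 0\<close>.\<close>

theorem dirichlet_beta_eq_euler_sum:
  assumes "Re s + real N > 1"
  shows "dirichlet_beta s = euler_sum N (beta_coeff s)"
proof -
  \<comment> \<open>Any choice of \<open>K s\<close> that is admissible at \<open>s\<close> gives the same function.\<close>
  define K where "K s = nat \<lceil>2 + norm s\<rceil>" for s :: complex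
  define B where "B s = euler_sum (K s) (beta_coeff s)" for s
  have K: "Re s + real (K s) > 1" for s
  proof -
    have "real (K s) \<ge> 2 + norm s" unfolding K_def by linarith
    then show ?thesis using abs_Re_le_cmod[of s] by linarith
  qed
  have B: "B s = euler_sum N (beta_coeff s)" if "Re s + real N > 1" for s N
    using euler_sum_beta_coeff_eq[OF that, of "max N (K s)"]
      euler_sum_beta_coeff_eq[OF K[of s], of "max N (K s)"] by (simp add: B_def)
  have "B holomorphic_on UNIV"
  proof (rule holomorphic_onI)
    fix s :: complex
    have "(B has_field_derivative euler_sum (K s) (beta_coeff' s)) (at s)"
    proof (rule has_field_derivative_transform_within_open[
          OF has_field_derivative_euler_sum_beta_coeff[OF K]])
      show "open {z. Re z > 1 - real (K s)}" by (simp add: open_halfspace_Re_gt)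
    qed (use K[of s] B in \<open>auto simp: algebra_simps\<close>)
    then show "B field_differentiable at s within UNIV"
      using field_differentiable_def by auto
  qed
  moreover have "(\<lambda>m. (-1) ^ m * of_nat (2 * m + 1) powr (- s)) sums B s" if "Re s > 0" for s
    using sums_beta_coeff[OF that K[of s]] by (simp add: B_def beta_coeff_def)
  moreover have "f = B" if "f holomorphic_on UNIV"
    "\<forall>s. Re s > 0 \<longrightarrow> (\<lambda>m. (-1) ^ m * of_nat (2 * m + 1) powr (- s)) sums f s" for f
  proof
    fix s
    show "f s = B s"
    proof (rule analytic_continuation_open[of "{s. Re s > 0}" UNIV f B])
      have "(1::complex) \<in> {s. Re s > 0}" by simp
      then show "{s. Re s > 0} \<noteq> {}" by blast
      show "f z = B z" if "z \<in> {s. Re s > 0}" for z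
        using that \<open>\<forall>s. Re s > 0 \<longrightarrow> _ s\<close> calculation(2)[of z] sums_unique2 by blast
    qed (use \<open>f holomorphic_on UNIV\<close> calculation(1) in \<open>auto simp: open_halfspace_Re_gt\<close>)
  qed
  ultimately have "dirichlet_beta = B"
    unfolding dirichlet_beta_def by (intro the_equality conjI allI impI; (elim conjE)?)
  then show ?thesis using B[OF assms] by simp
qed

lemma deriv_dirichlet_beta_eq_euler_sum:
  assumes "Re s + real N > 1"
  shows "deriv dirichlet_beta s = euler_sum N (beta_coeff' s)"
proof (rule DERIV_imp_deriv, rule has_field_derivative_transform_within_open[
      OF has_field_derivative_euler_sum_beta_coeff[OF assms]])
  show "open {z. Re z > 1 - real N}" by (simp add: open_halfspace_Re_gt)
qed (use assms dirichlet_beta_eq_euler_sum[of _ N] in \<open>auto simp: algebra_simps\<close>)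

text \<open>At \<open>s = -n\<close> the terms of \<open>\<beta>' + log 4 \<beta>\<close> are \<open>(2 m + 1)\<^sup>n (log 4 - log (2 m + 1))\<close>: the extra term
\<open>log 4 \<beta>\<close> is exactly what rescales the argument of the logarithm to \<open>(2 m + 1) / 4\<close>.\<close>

theorem deriv_dirichlet_beta_neg_nat:
  assumes "N \<ge> n + 2"
  shows "deriv dirichlet_beta (- of_nat n) + of_real (ln 4) * dirichlet_beta (- of_nat n) =
    euler_sum N (\<lambda>m. of_real (4 ^ n * - (((2 * real m + 1) / 4) ^ n * ln ((2 * real m + 1) / 4))))"
proof -
  let ?s = "- of_nat n :: complex"
  have N: "Re ?s + real N > 1" using assms by simp
  have "deriv dirichlet_beta ?s + of_real (ln 4) * dirichlet_beta ?s =
      euler_sum N (\<lambda>m. beta_coeff' ?s m + of_real (ln 4) * beta_coeff ?s m)"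
    using summable_mult[OF summable_beta_coeff[OF N], of "of_real (ln 4)"]
    by (subst euler_sum_add[OF summable_beta_coeff'[OF N]])
       (simp_all add: deriv_dirichlet_beta_eq_euler_sum[OF N] dirichlet_beta_eq_euler_sum[OF N]
         euler_sum_cmult[OF summable_beta_coeff[OF N]] fdiff_pow_cmult mult.left_commute)
  also have "(\<lambda>m. beta_coeff' ?s m + of_real (ln 4) * beta_coeff ?s m) =
      (\<lambda>m. of_real (4 ^ n * - (((2 * real m + 1) / 4) ^ n * ln ((2 * real m + 1) / 4))))"
  proof
    fix m
    have "beta_coeff ?s m = of_nat (2 * m + 1) ^ n"
      using powr_nat'[of "of_nat (2 * m + 1)" n] of_nat_eq_0_iff[of "2 * m + 1", where ?'a = complex]
      unfolding beta_coeff_def minus_minus by simp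
    then have bc: "beta_coeff ?s m = of_real ((2 * real m + 1) ^ n)" by (simp add: add.commute)
    have ln4: "ln ((2 * real m + 1) / 4) = ln (2 * real m + 1) - ln 4" by (simp add: ln_div)
    have pow4: "4 ^ n * ((2 * real m + 1) / 4) ^ n = (2 * real m + 1) ^ n"
      by (simp add: power_divide)
    have "4 ^ n * - (((2 * real m + 1) / 4) ^ n * ln ((2 * real m + 1) / 4)) =
        - (4 ^ n * ((2 * real m + 1) / 4) ^ n) * ln ((2 * real m + 1) / 4)" by simp
    also have "\<dots> = - ln (real (2 * m + 1)) * (2 * real m + 1) ^ n + ln 4 * (2 * real m + 1) ^ n"
      unfolding pow4 unfolding ln4 by (simp add: algebra_simps)
    finally have "- ln (real (2 * m + 1)) * (2 * real m + 1) ^ n + ln 4 * (2 * real m + 1) ^ n =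
        4 ^ n * - (((2 * real m + 1) / 4) ^ n * ln ((2 * real m + 1) / 4))" ..
    then show "beta_coeff' ?s m + of_real (ln 4) * beta_coeff ?s m =
        of_real (4 ^ n * - (((2 * real m + 1) / 4) ^ n * ln ((2 * real m + 1) / 4)))"
      unfolding beta_coeff'_def bc of_real_mult[symmetric] of_real_minus[symmetric] of_real_add[symmetric]
      by (rule arg_cong[where f = complex_of_real])
  qed
  finally show ?thesis .
qed

section \<open>Sequences with rapidly decaying differences\<close>

text \<open>Sequences that behave like symbols: differencing often enough beats any power of \<open>m\<close>. Unlike the
bare condition \<open>\<Delta>\<^sup>N b \<longlonglongrightarrow> 0\<close>, this one is stable under multiplication by polynomials.\<close>

definition tame :: "(nat \<Rightarrow> real) \<Rightarrow> bool" where
  "tame b \<longleftrightarrow> (\<forall>d. \<exists>N0. \<forall>N\<ge>N0. (\<lambda>m. real m ^ d * (fdiff ^^ N) b m) \<longlonglongrightarrow> 0)"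

lemma tame_affine_mult:
  assumes "tame b"
  shows "tame (\<lambda>m. (p + q * real m) * b m)"
  unfolding tame_def
proof
  fix d
  obtain N0 where N0: "\<And>N. N \<ge> N0 \<Longrightarrow> (\<lambda>m. real m ^ d * (fdiff ^^ N) b m) \<longlonglongrightarrow> 0"
    using assms unfolding tame_def by blast
  obtain N1 where N1: "\<And>N. N \<ge> N1 \<Longrightarrow> (\<lambda>m. real m ^ Suc d * (fdiff ^^ N) b m) \<longlonglongrightarrow> 0"
    using assms unfolding tame_def by blast
  have "(\<lambda>m. real m ^ d * (fdiff ^^ N) (\<lambda>m. (p + q * real m) * b m) m) \<longlonglongrightarrow> 0"
    if "N \<ge> Suc (max N0 N1)" for N
  proof -
    have "(\<lambda>m. real (Suc m) ^ d * (fdiff ^^ (N - 1)) b (Suc m)) \<longlonglongrightarrow> 0"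
      using LIMSEQ_Suc[OF N0[of "N - 1"]] that by simp
    then have shifted: "(\<lambda>m. real m ^ d * (fdiff ^^ (N - 1)) b (Suc m)) \<longlonglongrightarrow> 0"
      by (rule Lim_null_comparison[OF _ tendsto_rabs_zero, rotated])
         (auto simp: abs_mult intro!: always_eventually mult_right_mono power_mono)
    have "(\<lambda>m. p * (real m ^ d * (fdiff ^^ N) b m) + q * (real m ^ Suc d * (fdiff ^^ N) b m)
        - q * real N * (real m ^ d * (fdiff ^^ (N - 1)) b (Suc m))) \<longlonglongrightarrow> p * 0 + q * 0 - q * real N * 0"
      using that by (intro tendsto_intros N0 N1 shifted) auto
    then show ?thesis
      unfolding fdiff_pow_affine_mult by (simp add: algebra_simps)
  qed
  then show "\<exists>N0. \<forall>N\<ge>N0. (\<lambda>m. real m ^ d * (fdiff ^^ N) (\<lambda>m. (p + q * real m) * b m) m) \<longlonglongrightarrow> 0"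
    by blast
qed

lemma tame_affine_power_mult:
  assumes "tame b"
  shows "tame (\<lambda>m. (p + q * real m) ^ k * b m)"
proof (induction k)
  case (Suc k)
  from tame_affine_mult[OF this, of p q] show ?case by (simp add: mult.assoc)
qed (simp add: assms)

lemma tame_cmult: "tame b \<Longrightarrow> tame (\<lambda>m. k * b m)"
  using tame_affine_mult[of b k 0] by simp

lemma tame_add:
  assumes "tame b" "tame c"
  shows "tame (\<lambda>m. b m + c m)"
  unfolding tame_def
proof
  fix d
  obtain N0 where N0: "\<And>N. N \<ge> N0 \<Longrightarrow> (\<lambda>m. real m ^ d * (fdiff ^^ N) b m) \<longlonglongrightarrow> 0"
    using assms unfolding tame_def by blast
  obtain N1 where N1: "\<And>N. N \<ge> N1 \<Longrightarrow> (\<lambda>m. real m ^ d * (fdiff ^^ N) c m) \<longlonglongrightarrow> 0"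
    using assms unfolding tame_def by blast
  show "\<exists>N0. \<forall>N\<ge>N0. (\<lambda>m. real m ^ d * (fdiff ^^ N) (\<lambda>m. b m + c m) m) \<longlonglongrightarrow> 0"
    using tendsto_add[OF N0 N1]
    by (intro exI[of _ "max N0 N1"]) (auto simp: fdiff_pow_add distrib_left)
qed

lemma tame_sum:
  assumes "finite A" "\<And>i. i \<in> A \<Longrightarrow> tame (b i)"
  shows "tame (\<lambda>m. \<Sum>i\<in>A. b i m)"
  using assms
proof (induction A rule: finite_induct)
  case empty
  have "(fdiff ^^ N) (\<lambda>m. 0 :: real) m = 0" for N m
    by (induction N arbitrary: m) (simp_all add: fdiff_def)
  then show ?case by (simp add: tame_def)
qed (auto intro: tame_add)

lemma fdiff_pow_neg_ln_bounds:
  shows "0 \<le> (fdiff ^^ Suc k) (\<lambda>m. - ln ((2 * real m + 1) / 4)) m"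
    and "(fdiff ^^ Suc k) (\<lambda>m. - ln ((2 * real m + 1) / 4)) m \<le> fact k * (2 / (2 * real m + 1)) ^ Suc k"
proof -
  define F where "F i t = (case i of 0 \<Rightarrow> - ln t | Suc j \<Rightarrow> (-1) ^ Suc j * fact j / t ^ Suc j)" for i and t :: real
  have der: "(F i has_real_derivative F (Suc i) t) (at t)" if "t > 0" for i t
  proof (cases i)
    case 0
    then show ?thesis using that by (auto simp: F_def[abs_def] intro!: derivative_eq_intros)
  next
    case (Suc j)
    have F: "F (Suc j) = (\<lambda>t. (-1) ^ Suc j * fact j * inverse (t ^ Suc j))"
      by (auto simp: F_def divide_inverse)
    show ?thesis
      unfolding Suc F
      by (rule DERIV_cong[OF DERIV_cmult[OF DERIV_inverse_fun[OF DERIV_pow[of "Suc j" t]]]])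
         (use that in \<open>simp_all add: F_def field_simps power2_eq_square\<close>)
  qed
  define x where "x = (2 * real m + 1) / 4"
  have "x > 0" by (simp add: x_def)
  obtain \<xi> where \<xi>: "\<xi> \<ge> x"
    "(fdiff ^^ Suc k) (\<lambda>m. F 0 (x + 1/2 * real m)) 0 = (- (1/2)) ^ Suc k * F (0 + Suc k) \<xi>"
    using fdiff_pow_mean_value[where F = F and h = "1/2" and k = "Suc k" and i = 0, OF der] \<open>x > 0\<close> by auto
  have "(- (1/2)) ^ Suc k * F (0 + Suc k) \<xi> = ((- (1/2)) ^ Suc k * (-1) ^ Suc k) * (fact k / \<xi> ^ Suc k)"
    by (simp add: F_def)
  also have "\<dots> = fact k * (1 / (2 * \<xi>)) ^ Suc k"
    unfolding power_mult_distrib[symmetric] by (simp add: power_divide power_mult_distrib)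
  finally have eq: "(fdiff ^^ Suc k) (\<lambda>m. - ln ((2 * real m + 1) / 4)) m = fact k * (1 / (2 * \<xi>)) ^ Suc k"
    using \<xi>(2) fdiff_pow_from_0[of "Suc k" "\<lambda>m. - ln ((2 * real m + 1) / 4)" m]
    by (simp add: F_def x_def add_divide_distrib algebra_simps del: funpow.simps)
  have "1 / (2 * \<xi>) \<le> 2 / (2 * real m + 1)"
    using \<xi>(1) \<open>x > 0\<close> by (simp add: x_def field_simps)
  then show "(fdiff ^^ Suc k) (\<lambda>m. - ln ((2 * real m + 1) / 4)) m \<le> fact k * (2 / (2 * real m + 1)) ^ Suc k"
    unfolding eq using \<xi>(1) \<open>x > 0\<close> by (intro mult_left_mono power_mono) auto
  show "0 \<le> (fdiff ^^ Suc k) (\<lambda>m. - ln ((2 * real m + 1) / 4)) m"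
    unfolding eq using \<xi>(1) \<open>x > 0\<close> by simp
qed

text \<open>The key step for uniqueness. The differences \<open>x = \<Delta>\<^sup>j w\<close> and \<open>y = \<Delta>\<^sup>j u\<close> satisfy \<open>x + E x = y\<close>, hence
\<open>x\<^sub>m - x\<^sub>m\<^sub>+\<^sub>2 = y\<^sub>m - y\<^sub>m\<^sub>+\<^sub>1 \<ge> 0\<close>. So \<open>x\<close> decreases along steps of two to its limit zero, which makes it
non-negative; then \<open>x \<le> x + E x = y\<close>. The sign of \<open>w\<close> itself serves to get the limit zero, and
excludes adding a multiple of \<open>(-1)\<^sup>m\<close>.\<close>

lemma fdiff_pow_antiperiodic_bounds:
  fixes u w :: "nat \<Rightarrow> real"
  assumes uw: "\<And>m. w m + w (Suc m) = u m" and w0: "\<And>m. w m \<ge> 0" and "u \<longlonglongrightarrow> 0"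
    and cm: "\<And>j m. (fdiff ^^ j) u m \<ge> 0"
  shows "0 \<le> (fdiff ^^ j) w m \<and> (fdiff ^^ j) w m \<le> (fdiff ^^ j) u m"
proof -
  have D: "(fdiff ^^ j) w m + (fdiff ^^ j) w (Suc m) = (fdiff ^^ j) u m" for j m
  proof -
    have "u = (\<lambda>m. w m + w (Suc m))" using uw by auto
    then show ?thesis by (simp only: fdiff_pow_add fdiff_pow_shift)
  qed
  have "\<bar>w m\<bar> \<le> u m" for m using uw[of m] w0[of m] w0[of "Suc m"] by simp
  then have "w \<longlonglongrightarrow> 0"
    using \<open>u \<longlonglongrightarrow> 0\<close> by (intro Lim_null_comparison[of w u]) auto
  have nonneg: "0 \<le> (fdiff ^^ j) w m" for j m
  proof -
    have step: "(fdiff ^^ j) w (m + 2 * Suc i) \<le> (fdiff ^^ j) w (m + 2 * i)" for i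
      using D[of j "m + 2 * i"] D[of j "Suc (m + 2 * i)"] cm[of "Suc j" "m + 2 * i"]
      by (simp add: fdiff_def)
    have le: "(fdiff ^^ j) w (m + 2 * i) \<le> (fdiff ^^ j) w m" for i
    proof (induction i)
      case (Suc i)
      then show ?case using step[of i] by linarith
    qed simp
    have "(\<lambda>i. (fdiff ^^ j) w (m + 2 * i)) \<longlonglongrightarrow> 0"
      by (rule filterlim_compose[OF fdiff_pow_tendsto_0[OF \<open>w \<longlonglongrightarrow> 0\<close>]])
         (auto intro!: filterlim_subseq simp: strict_mono_def)
    then show ?thesis using le by (intro LIMSEQ_le_const2) auto
  qed
  show ?thesis using D[of j m] nonneg[of j m] nonneg[of j "Suc m"] by simp
qed

text \<open>With \<open>w\<^sub>l = \<Delta>\<^sup>l\<^sup>+\<^sup>1 a\<^sub>l\<close>, the recursion factors as \<open>1 - E\<^sup>2 = \<Delta> (1 + E)\<close> and gives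
\<open>w\<^sub>l\<^sub>+\<^sub>1 + E w\<^sub>l\<^sub>+\<^sub>1 = w\<^sub>l\<close>, so the previous lemma bounds all differences of all \<open>w\<^sub>l\<close> by those of
\<open>w\<^sub>0\<close>.\<close>

lemma tame_iterated_antidifference:
  fixes a :: "nat \<Rightarrow> nat \<Rightarrow> real"
  assumes a0: "\<And>m. a 0 m = - ln ((2 * real m + 1) / 4)"
    and rec: "\<And>l m. a (Suc l) m - a (Suc l) (m + 2) = a l m"
    and pos: "\<And>l m. (fdiff ^^ Suc l) (a l) m \<ge> 0"
  shows "tame (a l)"
proof -
  have a0': "a 0 = (\<lambda>m. - ln ((2 * real m + 1) / 4))" using a0 by auto
  have r: "(\<lambda>m. 2 / (2 * real m + 1)) \<longlonglongrightarrow> 0" by real_asymp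
  have bounds: "0 \<le> (fdiff ^^ (j + Suc l)) (a l) m \<and>
      (fdiff ^^ (j + Suc l)) (a l) m \<le> (fdiff ^^ Suc j) (a 0) m" for j m
  proof (induction l arbitrary: j m)
    case 0
    show ?case using fdiff_pow_neg_ln_bounds(1)[of j m] unfolding a0' by simp
  next
    case (Suc l)
    have sum: "(\<lambda>m. fdiff (a (Suc l)) m + fdiff (a (Suc l)) (Suc m)) = a l"
      using rec by (auto simp: fdiff_def)
    have "(fdiff ^^ Suc (Suc l)) (a (Suc l)) m + (fdiff ^^ Suc (Suc l)) (a (Suc l)) (Suc m) =
        (fdiff ^^ Suc l) (a l) m" for m
      unfolding sum[symmetric] fdiff_pow_add fdiff_pow_shift[of _ "fdiff (a (Suc l))"]
      by (simp only: funpow_Suc_right o_apply)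
    moreover have "norm ((fdiff ^^ Suc l) (a l) m) \<le> 2 / (2 * real m + 1)" for m
      using Suc.IH[of 0 m] fdiff_pow_neg_ln_bounds(2)[of 0 m] unfolding a0'[symmetric]
      by (simp del: funpow.simps)
    then have "(fdiff ^^ Suc l) (a l) \<longlonglongrightarrow> 0"
      by (intro Lim_null_comparison[OF always_eventually r]) auto
    ultimately have "0 \<le> (fdiff ^^ j) ((fdiff ^^ Suc (Suc l)) (a (Suc l))) m \<and>
        (fdiff ^^ j) ((fdiff ^^ Suc (Suc l)) (a (Suc l))) m \<le> (fdiff ^^ j) ((fdiff ^^ Suc l) (a l)) m"
      using pos Suc.IH by (intro fdiff_pow_antiperiodic_bounds) (simp_all only: fdiff_pow_funpow_add)
    then show ?case using Suc.IH[of j m] unfolding fdiff_pow_funpow_add by linarith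
  qed
  show ?thesis
    unfolding tame_def
  proof (intro allI exI[of _ "Suc _"] impI)
    fix d N assume "Suc (l + d) \<le> N"
    define k where "k = N - Suc l"
    have "k \<ge> d" and N: "N = k + Suc l" using \<open>Suc (l + d) \<le> N\<close> by (auto simp: k_def)
    have "norm (real m ^ d * (fdiff ^^ N) (a l) m) \<le> fact k * 2 ^ (k - d) * (2 / (2 * real m + 1))" for m
    proof -
      define r where "r = 2 / (2 * real m + 1)"
      have "0 \<le> r" "r \<le> 2" "real m * r \<le> 1" by (auto simp: r_def field_simps)
      have "norm (real m ^ d * (fdiff ^^ N) (a l) m) = real m ^ d * (fdiff ^^ N) (a l) m"
        using bounds[of k m] unfolding N by (simp only: real_norm_def) (simp del: funpow.simps)
      also have "\<dots> \<le> real m ^ d * (fact k * r ^ Suc k)"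
        using bounds[of k m] fdiff_pow_neg_ln_bounds(2)[of k m] unfolding N a0' r_def
        by (intro mult_left_mono) (linarith, simp)
      \<comment> \<open>Of the \<open>k + 1\<close> factors \<open>r\<close>, \<open>d\<close> absorb the power of \<open>m\<close> and one is kept for the limit.\<close>
      also have "r ^ Suc k = r ^ d * r ^ (k - d) * r"
        using \<open>k \<ge> d\<close> by (simp add: power_add[symmetric])
      also have "real m ^ d * (fact k * (r ^ d * r ^ (k - d) * r)) =
          fact k * ((real m * r) ^ d * r ^ (k - d)) * r"
        by (simp add: power_mult_distrib)
      also have "\<dots> \<le> fact k * (1 * 2 ^ (k - d)) * r"
        using \<open>0 \<le> r\<close> \<open>r \<le> 2\<close> \<open>real m * r \<le> 1\<close>
        by (intro mult_right_mono mult_left_mono mult_mono power_mono power_le_one) auto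
      finally show ?thesis by (simp add: r_def)
    qed
    moreover have "(\<lambda>m. fact k * 2 ^ (k - d) * (2 / (2 * real m + 1))) \<longlonglongrightarrow> 0"
      using tendsto_mult_right_zero[OF r] by blast
    ultimately show "(\<lambda>m. real m ^ d * (fdiff ^^ N) (a l) m) \<longlonglongrightarrow> 0"
      using Lim_null_comparison[OF always_eventually[OF allI]] by fast
  qed
qed

section \<open>Logarithms of the multiple gamma functions\<close>

lemma of_real_pos_notin_nonpos_Ints:
  assumes "x > 0"
  shows "complex_of_real x \<notin> \<int>\<^sub>\<le>\<^sub>0"
  using assms by (auto simp: of_real_in_nonpos_Ints_iff elim!: nonpos_Ints_cases)

text \<open>Near the positive axis \<open>log_gamma_real\<close> is the restriction of the holomorphic function \<open>Ln (Gam m)\<close>,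
which supplies derivatives of all orders and so gives content to the iterated \<open>deriv\<close> in the
convexity condition.\<close>

lemma higher_deriv_log_gamma_real:
  assumes "multiple_gamma_functions Gam" "m \<ge> 1" "x > 0"
  shows "((deriv ^^ i) (log_gamma_real Gam m) has_real_derivative
    (deriv ^^ Suc i) (log_gamma_real Gam m) x) (at x)"
proof -
  from assms(1,2) have an: "Gam m analytic_on - \<int>\<^sub>\<le>\<^sub>0"
    and pos: "\<And>x::real. x > 0 \<Longrightarrow> Gam m (of_real x) \<in> \<real> \<and> Re (Gam m (of_real x)) > 0"
    unfolding multiple_gamma_functions_def by blast+
  define U where "U = - \<int>\<^sub>\<le>\<^sub>0 \<inter> Gam m -` {w. Re w > 0}"
  define L where "L = (\<lambda>z. Ln (Gam m z))"
  have hol: "Gam m holomorphic_on - \<int>\<^sub>\<le>\<^sub>0" using an by (rule analytic_imp_holomorphic)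
  have "open U"
    unfolding U_def
    by (intro continuous_open_preimage holomorphic_on_imp_continuous_on[OF hol] open_halfspace_Re_gt
        open_Compl closed_nonpos_Ints)
  have "L holomorphic_on U"
    unfolding L_def
    by (intro holomorphic_on_Ln' holomorphic_on_subset[OF hol]) (auto simp: U_def complex_nonpos_Reals_iff)
  have U: "complex_of_real t \<in> U" if "t > 0" for t
    using that pos[OF that] of_real_pos_notin_nonpos_Ints by (simp add: U_def)
  define G where "G i t = Re ((deriv ^^ i) L (of_real t))" for i and t :: real
  have G: "(G i has_real_derivative G (Suc i) t) (at t)" if "t > 0" for i t
  proof -
    have "(deriv ^^ i) L holomorphic_on U"
      using \<open>L holomorphic_on U\<close> \<open>open U\<close> by (rule holomorphic_higher_deriv)
    from holomorphic_derivI[OF this \<open>open U\<close> U[OF that]]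
    have "((\<lambda>t. (deriv ^^ i) L (of_real t)) has_vector_derivative (deriv ^^ Suc i) L (of_real t)) (at t)"
      using has_vector_derivative_real_field by fastforce
    then show ?thesis unfolding G_def by (rule has_field_derivative_Re)
  qed
  have eq: "(deriv ^^ i) (log_gamma_real Gam m) t = G i t" if "t > 0" for i t
    using that
  proof (induction i arbitrary: t)
    case 0
    obtain r where r: "Gam m (of_real t) = of_real r" "r > 0"
      using pos[OF 0] by (auto elim!: Reals_cases)
    then show ?case by (simp add: log_gamma_real_def G_def L_def Ln_of_real)
  next
    case (Suc i)
    have "\<forall>\<^sub>F s in nhds t. (deriv ^^ i) (log_gamma_real Gam m) s = G i s"
      using eventually_nhds_in_open[of "{0<..}" t] Suc by (auto elim!: eventually_mono)
    then have "deriv ((deriv ^^ i) (log_gamma_real Gam m)) t = deriv (G i) t"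
      by (rule deriv_cong_ev) simp
    then show ?case using DERIV_imp_deriv[OF G[OF Suc.prems]] by simp
  qed
  have "((deriv ^^ i) (log_gamma_real Gam m) has_real_derivative G (Suc i) x) (at x)"
    using G[OF \<open>x > 0\<close>, of i]
    by (rule has_field_derivative_transform_within_open[where S = "{0<..}"]) (use \<open>x > 0\<close> eq in auto)
  then show ?thesis using eq[OF \<open>x > 0\<close>, of "Suc i"] by simp
qed

lemma log_gamma_real_1_plus_1:
  assumes "multiple_gamma_functions Gam" "x > 0"
  shows "log_gamma_real Gam 1 (x + 1) = log_gamma_real Gam 1 x + ln x"
proof -
  have "Gam 1 = Gamma" using assms(1) by (simp add: multiple_gamma_functions_def)
  have "log_gamma_real Gam 1 t = ln (Gamma t)" for t
    unfolding log_gamma_real_def \<open>Gam 1 = Gamma\<close> by (simp add: Gamma_complex_of_real)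
  moreover have "x \<notin> \<int>\<^sub>\<le>\<^sub>0" using \<open>x > 0\<close> by (auto elim!: nonpos_Ints_cases)
  moreover have "Gamma x \<noteq> 0" using Gamma_real_pos[OF \<open>x > 0\<close>] by linarith
  ultimately show ?thesis
    using \<open>x > 0\<close> Gamma_plus1[of x] by (simp add: ln_mult)
qed

lemma log_gamma_real_Suc_plus_1:
  assumes "multiple_gamma_functions Gam" "m \<ge> 1" "x > 0"
  shows "log_gamma_real Gam (Suc m) (x + 1) = log_gamma_real Gam (Suc m) x - log_gamma_real Gam m x"
proof -
  from assms(1,2) have pos: "Gam k (of_real x) \<in> \<real> \<and> Re (Gam k (of_real x)) > 0" if "k \<ge> 1" for k
    using \<open>x > 0\<close> that unfolding multiple_gamma_functions_def by blast
  have "complex_of_real x \<notin> \<int>\<^sub>\<le>\<^sub>0" using \<open>x > 0\<close> by (rule of_real_pos_notin_nonpos_Ints)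
  with assms(1,2) have "Gam (m + 1) (of_real x + 1) = Gam (m + 1) (of_real x) / Gam m (of_real x)"
    unfolding multiple_gamma_functions_def by blast
  moreover obtain p where "Gam (Suc m) (of_real x) = of_real p" "p > 0"
    using pos[of "Suc m"] by (auto elim!: Reals_cases)
  moreover obtain q where "Gam m (of_real x) = of_real q" "q > 0"
    using pos[OF assms(2)] by (auto elim!: Reals_cases)
  ultimately show ?thesis
    by (simp add: log_gamma_real_def ln_div flip: of_real_divide)
qed

section \<open>The combination of log-gamma functions that solves the difference equation\<close>

lemma sum_from_1_to_Suc: "(\<Sum>j=1..Suc n. f j) = (\<Sum>i\<le>n. f (Suc i))"
  unfolding One_nat_def sum.atLeast1_atMost_eq lessThan_Suc_atMost ..

text \<open>In this form the needed identities for \<open>P_poly\<close> are instances of general facts on differences.\<close>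

lemma P_poly_Suc_Suc:
  "P_poly (Suc n) (Suc r) y = (-1) ^ n * (fdiff ^^ r) (\<lambda>i. ((1 - y) + 1 * of_nat i) ^ n) 0"
proof -
  have "P_poly (Suc n) (Suc r) y =
      (\<Sum>i\<le>r. of_nat (r choose i) * (-1) ^ (Suc i + Suc n) * (of_nat (Suc i) - y) ^ n)"
    unfolding P_poly_def sum_from_1_to_Suc by simp
  also have "\<dots> = (-1) ^ n * (fdiff ^^ r) (\<lambda>i. ((1 - y) + 1 * of_nat i) ^ n) 0"
    unfolding fdiff_pow_binomial sum_distrib_left
    by (intro sum.cong) (simp_all add: power_add algebra_simps)
  finally show ?thesis .
qed

lemma P_poly_plus_1:
  "P_poly (Suc n) (Suc (Suc r)) (y + 1) = P_poly (Suc n) (Suc r) (y + 1) - P_poly (Suc n) (Suc r) y"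
proof -
  have "(fdiff ^^ r) (\<lambda>i. ((1 - (y + 1)) + 1 * real i) ^ n) (Suc 0) =
      (fdiff ^^ r) (\<lambda>i. ((1 - y) + 1 * real i) ^ n) 0"
    by (subst fdiff_pow_shift[symmetric]) (simp add: algebra_simps)
  then show ?thesis
    unfolding P_poly_Suc_Suc fdiff_pow_Suc[of r] by (simp add: algebra_simps)
qed

lemma P_poly_eq_0: "r > n \<Longrightarrow> P_poly (Suc n) (Suc r) y = 0"
  unfolding P_poly_Suc_Suc by (simp only: fdiff_pow_affine_power_eq_0 mult_zero_right)

text \<open>In terms of the Hurwitz zeta function this is \<open>\<zeta>'(-n, x) - \<zeta>'(-n)\<close>.\<close>

definition gamma_combination :: "(nat \<Rightarrow> complex \<Rightarrow> complex) \<Rightarrow> nat \<Rightarrow> real \<Rightarrow> real" where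
  "gamma_combination Gam n x =
     (\<Sum>r\<le>n. P_poly (Suc n) (Suc r) x * log_gamma_real Gam (Suc r) x)"

text \<open>Summation by parts: a unit shift of \<open>P_poly\<close> in \<open>x\<close> is compensated by the shift of the index \<open>l\<close>
in the functional equation. Since \<open>\<Gamma>(x + 1) = x \<Gamma>(x)\<close>, the function \<open>- log\<close> takes the place of
\<open>log \<Gamma>\<^sub>0\<close>; it is what the lower boundary term consists of, and the upper one vanishes as an
\<open>(n + 1)\<close>-st difference of a polynomial of degree \<open>n\<close>.\<close>

lemma gamma_combination_plus_1:
  assumes "multiple_gamma_functions Gam" "x > 0"
  shows "gamma_combination Gam n (x + 1) = gamma_combination Gam n x + x ^ n * ln x"
proof -
  define G where "G r = (if r = 0 then - ln x else log_gamma_real Gam r x)" for r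
  let ?p = "\<lambda>r y. P_poly (Suc n) (Suc r) y"
  have "log_gamma_real Gam (Suc r) (x + 1) = G (Suc r) - G r" for r
    using log_gamma_real_1_plus_1[OF assms] log_gamma_real_Suc_plus_1[OF assms(1) _ assms(2), of r]
    by (cases r) (auto simp: G_def)
  then have "gamma_combination Gam n (x + 1) - gamma_combination Gam n x =
      (\<Sum>r\<le>n. ?p r (x + 1) * (G (Suc r) - G r) - ?p r x * G (Suc r))"
    by (simp add: gamma_combination_def G_def sum_subtractf)
  also have "\<dots> = (\<Sum>r\<le>n. ?p (Suc r) (x + 1) * G (Suc r) - ?p r (x + 1) * G r)"
    unfolding P_poly_plus_1 by (simp add: algebra_simps)
  also have "\<dots> = ?p (Suc n) (x + 1) * G (Suc n) - ?p 0 (x + 1) * G 0"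
  proof -
    have "(\<Sum>r\<le>k. ?p (Suc r) (x + 1) * G (Suc r) - ?p r (x + 1) * G r) =
        ?p (Suc k) (x + 1) * G (Suc k) - ?p 0 (x + 1) * G 0" for k
      by (induction k) simp_all
    then show ?thesis .
  qed
  also have "\<dots> = x ^ n * ln x"
    by (simp add: P_poly_eq_0) (simp add: P_poly_Suc_Suc G_def flip: power_mult_distrib)
  finally show ?thesis by simp
qed

text \<open>A unit step in \<open>x\<close> is two steps along the \<open>x\<^sub>m\<close>, so the functional equation is the recursion of
lemma \<open>tame_iterated_antidifference\<close>, and its positivity hypothesis is the convexity condition
transported by the mean value theorem.\<close>

lemma tame_log_gamma_real:
  assumes "multiple_gamma_functions Gam"
  shows "tame (\<lambda>m. log_gamma_real Gam (Suc l) ((2 * real m + 1) / 4))"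
proof -
  define a where "a l m = (if l = 0 then - ln ((2 * real m + 1) / 4)
    else log_gamma_real Gam l ((2 * real m + 1) / 4))" for l m
  have "tame (a (Suc l))"
  proof (rule tame_iterated_antidifference)
    fix l m
    define x where "x = (2 * real m + 1) / 4"
    have "x > 0" by (simp add: x_def)
    have x1: "(2 * real (m + 2) + 1) / 4 = x + 1" by (simp add: x_def)
    show "a (Suc l) m - a (Suc l) (m + 2) = a l m"
      using log_gamma_real_1_plus_1[OF assms \<open>x > 0\<close>]
        log_gamma_real_Suc_plus_1[OF assms _ \<open>x > 0\<close>, of l]
      unfolding a_def x1 x_def[symmetric] by (cases l) auto
    show "(fdiff ^^ Suc l) (a l) m \<ge> 0"
    proof (cases "l = 0")
      case True
      then show ?thesis
        using fdiff_pow_neg_ln_bounds(1)[of 0 m] by (simp add: a_def[abs_def])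
    next
      case False
      define F where "F i = (deriv ^^ i) (log_gamma_real Gam l)" for i
      have "(F i has_real_derivative F (Suc i) t) (at t)" if "t > 0" for i t
        unfolding F_def using False that by (intro higher_deriv_log_gamma_real[OF assms]) auto
      from fdiff_pow_mean_value[where F = F and h = "1/2" and k = "Suc l" and i = 0, OF this _ \<open>x > 0\<close>]
      obtain \<xi> where \<xi>: "\<xi> \<ge> x"
        "(fdiff ^^ Suc l) (\<lambda>m. F 0 (x + 1/2 * real m)) 0 = (- (1/2)) ^ Suc l * F (Suc l) \<xi>"
        by auto
      have "0 \<le> (-1) ^ (l + 1) * (deriv ^^ (l + 1)) (log_gamma_real Gam l) \<xi>"
        using assms False \<xi>(1) \<open>x > 0\<close> unfolding multiple_gamma_functions_def by auto
      then have "0 \<le> (1/2) ^ Suc l * ((-1) ^ Suc l * F (Suc l) \<xi>)"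
        unfolding F_def Suc_eq_plus1 by (rule mult_nonneg_nonneg[rotated]) simp
      also have "\<dots> = (- (1/2)) ^ Suc l * F (Suc l) \<xi>"
        unfolding mult.assoc[symmetric] power_mult_distrib[symmetric] by simp
      also have "\<dots> = (fdiff ^^ Suc l) (a l) m"
        unfolding \<xi>(2)[symmetric] fdiff_pow_from_0[of "Suc l" "a l" m, symmetric]
        by (rule arg_cong[where f = "\<lambda>c. (fdiff ^^ Suc l) c 0"])
           (use False in \<open>auto simp: F_def a_def x_def field_simps\<close>)
      finally show ?thesis .
    qed
  qed (simp add: a_def)
  then show ?thesis by (simp add: a_def[abs_def])
qed

lemma tame_gamma_combination:
  assumes "multiple_gamma_functions Gam"
  shows "tame (\<lambda>m. gamma_combination Gam n ((2 * real m + 1) / 4))"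
  unfolding gamma_combination_def
proof (intro tame_sum)
  fix r
  let ?g = "\<lambda>m. log_gamma_real Gam (Suc r) ((2 * real m + 1) / 4)"
  have "tame (\<lambda>m. (\<Sum>i\<le>r. (-1) ^ n * ((-1) ^ i * of_nat (r choose i)) *
      (((real i + 3/4) + (- 1/2) * real m) ^ n * ?g m)))"
    by (intro tame_sum tame_cmult tame_affine_power_mult tame_log_gamma_real assms) simp
  also have "(\<lambda>m. (\<Sum>i\<le>r. (-1) ^ n * ((-1) ^ i * of_nat (r choose i)) *
      (((real i + 3/4) + (- 1/2) * real m) ^ n * ?g m))) =
      (\<lambda>m. P_poly (Suc n) (Suc r) ((2 * real m + 1) / 4) * ?g m)"
    unfolding P_poly_Suc_Suc fdiff_pow_binomial sum_distrib_left sum_distrib_right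
    by (intro ext sum.cong) (simp_all add: algebra_simps add_divide_distrib)
  finally show "tame (\<lambda>m. P_poly (Suc n) (Suc r) ((2 * real m + 1) / 4) * ?g m)" .
qed simp

lemma D_sum_eq: "D_sum Gam n = 4 ^ n * (gamma_combination Gam n (1/4) - gamma_combination Gam n (3/4))"
  unfolding D_sum_def gamma_combination_def Suc_eq_plus1[symmetric] sum_from_1_to_Suc sum_subtractf ..

theorem D_sum_eq_beta:
  assumes "multiple_gamma_functions Gam"
  shows "complex_of_real (D_sum Gam n) =
    deriv dirichlet_beta (- of_nat n) + complex_of_real (ln 4) * dirichlet_beta (- of_nat n)"
proof -
  define s where "s m = gamma_combination Gam n ((2 * real m + 1) / 4)" for m
  define b where "b m = 4 ^ n * (s m - s (Suc m))" for m
  have "tame s" unfolding s_def[abs_def] by (rule tame_gamma_combination[OF assms])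
  then obtain N0 where N0: "\<And>N. N \<ge> N0 \<Longrightarrow> (fdiff ^^ N) s \<longlonglongrightarrow> 0"
    unfolding tame_def by (metis (no_types, lifting) ext mult_1 power_0)
  \<comment> \<open>Large enough both for the convergence of the regularised beta series and for the decay.\<close>
  define N where "N = max N0 (n + 2)"
  have "(\<lambda>m. 4 ^ n * ((fdiff ^^ N) s m - (fdiff ^^ N) s (Suc m))) \<longlonglongrightarrow> 4 ^ n * (0 - 0)"
    by (intro tendsto_intros N0 LIMSEQ_Suc) (auto simp: N_def)
  moreover have "(fdiff ^^ N) b = (\<lambda>m. 4 ^ n * ((fdiff ^^ N) s m - (fdiff ^^ N) s (Suc m)))"
    unfolding b_def[abs_def] by (intro ext) (simp only: fdiff_pow_cmult fdiff_pow_diff fdiff_pow_shift)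
  ultimately have "(fdiff ^^ N) b \<longlonglongrightarrow> 0" by simp
  then have lim: "(fdiff ^^ N) (\<lambda>m. complex_of_real (b m)) \<longlonglongrightarrow> 0"
    unfolding fdiff_pow_of_real using tendsto_of_real[of _ 0] by fastforce
  have "b m + b (Suc m) = 4 ^ n * - (((2 * real m + 1) / 4) ^ n * ln ((2 * real m + 1) / 4))" for m
  proof -
    have "(2 * real (Suc (Suc m)) + 1) / 4 = (2 * real m + 1) / 4 + 1" by simp
    then have "s (Suc (Suc m)) = s m + ((2 * real m + 1) / 4) ^ n * ln ((2 * real m + 1) / 4)"
      unfolding s_def by (simp only:) (rule gamma_combination_plus_1[OF assms], simp)
    then show ?thesis by (simp add: b_def algebra_simps)
  qed
  then have "complex_of_real (b m) + complex_of_real (b (Suc m)) =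
      of_real (4 ^ n * - (((2 * real m + 1) / 4) ^ n * ln ((2 * real m + 1) / 4)))" for m
    by (metis of_real_add)
  from euler_sum_unique[OF this lim]
  have "of_real (b 0) = deriv dirichlet_beta (- of_nat n) + of_real (ln 4) * dirichlet_beta (- of_nat n)"
    by (subst deriv_dirichlet_beta_neg_nat[of n N]) (auto simp: N_def)
  then show ?thesis by (simp add: D_sum_eq b_def s_def)
qed

section \<open>Generalised Eulerian numbers\<close>

text \<open>By the functional equation, raising the argument by one acts on the index \<open>i\<close> as \<open>1 - E\<close>. The bound
\<open>j + k < m\<close> keeps the index of the gamma function positive.\<close>

lemma log_gamma_real_plus_nat:
  assumes "multiple_gamma_functions Gam" "x > 0" "j + k < m"
  shows "log_gamma_real Gam (m - j) (x + real k) = (fdiff ^^ k) (\<lambda>i. log_gamma_real Gam (m - i) x) j"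
  using assms(3)
proof (induction k arbitrary: j)
  case (Suc k)
  have "m - j = Suc (m - Suc j)" using Suc.prems by simp
  then have "log_gamma_real Gam (m - j) (x + real k + 1) =
      log_gamma_real Gam (m - j) (x + real k) - log_gamma_real Gam (m - Suc j) (x + real k)"
    using log_gamma_real_Suc_plus_1[OF assms(1), of "m - Suc j" "x + real k"] Suc.prems assms(2) by simp
  then show ?case
    unfolding fdiff_pow_Suc using Suc.IH[of j] Suc.IH[of "Suc j"] Suc.prems by (simp add: add_ac)
qed simp

lemma gen_euler_T_eq_0: "k < 0 \<or> k > int n \<Longrightarrow> gen_euler_T n k = 0"
  by (cases n) auto

text \<open>The Eulerian recurrence, transposed: it acts on the test sequence instead of the weights.\<close>

lemma sum_gen_euler_T_Suc:
  fixes \<phi> :: "nat \<Rightarrow> real"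
  shows "(\<Sum>k\<le>Suc n. of_int (gen_euler_T (Suc n) (int k)) * \<phi> k) =
    (\<Sum>k\<le>n. of_int (gen_euler_T n (int k)) *
      ((4 * (real n - real k) + 1) * \<phi> (Suc k) + (4 * real k + 3) * \<phi> k))"
proof -
  have "(\<Sum>k\<le>Suc n. of_int (gen_euler_T (Suc n) (int k)) * \<phi> k) =
      (\<Sum>k\<le>Suc n. (4 * (real n - real k) + 5) * of_int (gen_euler_T n (int k - 1)) * \<phi> k) +
      (\<Sum>k\<le>Suc n. (4 * real k + 3) * of_int (gen_euler_T n (int k)) * \<phi> k)"
    unfolding sum.distrib[symmetric] by (intro sum.cong) (auto simp: algebra_simps)
  also have "(\<Sum>k\<le>Suc n. (4 * (real n - real k) + 5) * of_int (gen_euler_T n (int k - 1)) * \<phi> k) =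
      (\<Sum>k\<le>n. (4 * (real n - real k) + 1) * of_int (gen_euler_T n (int k)) * \<phi> (Suc k))"
    by (subst sum.atMost_Suc_shift) (simp add: gen_euler_T_eq_0 algebra_simps)
  also have "(\<Sum>k\<le>Suc n. (4 * real k + 3) * of_int (gen_euler_T n (int k)) * \<phi> k) =
      (\<Sum>k\<le>n. (4 * real k + 3) * of_int (gen_euler_T n (int k)) * \<phi> k)"
    by (simp add: gen_euler_T_eq_0)
  finally show ?thesis
    by (simp add: sum.distrib[symmetric] algebra_simps)
qed

text \<open>The Leibniz rule, with the shifted term at \<open>1\<close> rewritten through differences at \<open>0\<close>. The sign
\<open>(-1)\<^sup>r\<close> makes the recurrence match the one of the binomial sums below.\<close>

lemma fdiff_pow_affine_power_Suc:
  fixes p q :: real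
  defines "W \<equiv> \<lambda>n r. (-1) ^ r * (fdiff ^^ r) (\<lambda>i. (p + q * real i) ^ n) 0"
  shows "W (Suc n) (Suc r) = (p + q * real (Suc r)) * W n (Suc r) + q * real (Suc r) * W n r"
    and "W (Suc n) 0 = p * W n 0"
  unfolding W_def power_Suc fdiff_pow_affine_mult
  by (simp_all only: diff_Suc_1 fdiff_pow_Suc[of r]) (simp_all add: algebra_simps)

lemma real_mult_binomial:
  "real k * real (k choose i) = real i * real (k choose i) + real (Suc i) * real (k choose Suc i)"
proof (cases "i \<le> k")
  case True
  have "real (Suc i) * real (k choose Suc i) = real (k - i) * real (k choose i)"
    unfolding of_nat_mult[symmetric] binomial_absorption binomial_absorb_comp ..
  with True show ?thesis by (simp add: of_nat_diff algebra_simps)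
qed (simp add: binomial_eq_0)

text \<open>A Worpitzky identity for both families of binomial sums at once; \<open>p\<close> is \<open>1\<close> for \<open>k choose i\<close> and
\<open>3\<close> for \<open>(n - k) choose i\<close>. The index of the difference is \<open>n - i\<close>, so \<open>i = 0\<close> and \<open>i = n + 1\<close> are
the two ends where one term of the recurrence drops out.\<close>

lemma type_B_worpitzky_recurrence_unique:
  fixes A :: "nat \<Rightarrow> nat \<Rightarrow> real"
  assumes A0: "A 0 0 = 1"
    and AS0: "\<And>n. A (Suc n) 0 = 4 * real (Suc n) * A n 0"
    and ASS: "\<And>n i. A (Suc n) (Suc i) =
      (4 * real n - 4 * real i) * A n (Suc i) + (4 * (real n - real i) + p) * A n i"
    and "i \<le> n"
  shows "A n i = (-1) ^ (n - i) * (fdiff ^^ (n - i)) (\<lambda>j. (p + 4 * real j) ^ n) 0"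
  using \<open>i \<le> n\<close>
proof (induction n arbitrary: i)
  case 0
  then show ?case by (simp add: A0)
next
  case (Suc n)
  show ?case
  proof (cases i)
    case 0
    have "(fdiff ^^ Suc n) (\<lambda>j. (p + 4 * real j) ^ n) 0 = 0"
      by (rule fdiff_pow_affine_power_eq_0) simp
    with 0 show ?thesis
      using fdiff_pow_affine_power_Suc(1)[where n = n and r = n and p = p and q = 4] Suc.IH[of 0]
      by (simp add: AS0 del: funpow.simps)
  next
    case (Suc i')
    show ?thesis
    proof (cases "i' = n")
      case True
      with Suc show ?thesis
        using fdiff_pow_affine_power_Suc(2)[where n = n and p = p and q = 4] Suc.IH[of n] by (simp add: ASS)
    next
      case False
      define r where "r = n - Suc i'"
      have r: "n - i' = Suc r" "real n = real (Suc r) + real i'" "Suc i' \<le> n" "i' \<le> n"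
        using False Suc Suc.prems by (auto simp: r_def)
      show ?thesis
        unfolding Suc ASS Suc.IH[OF r(3)] Suc.IH[OF r(4)] r_def[symmetric] diff_Suc_Suc r(1)
          fdiff_pow_affine_power_Suc(1)
        by (simp add: r(2) algebra_simps del: funpow.simps)
    qed
  qed
qed

lemma sum_gen_euler_T_binomial:
  assumes "i \<le> n"
  shows "(\<Sum>k\<le>n. of_int (gen_euler_T n (int k)) * real (k choose i)) =
    (-1) ^ (n - i) * (fdiff ^^ (n - i)) (\<lambda>j. (1 + 4 * real j) ^ n) 0"
  using _ _ _ assms
proof (rule type_B_worpitzky_recurrence_unique)
  fix n i
  show "(\<Sum>k\<le>Suc n. of_int (gen_euler_T (Suc n) (int k)) * real (k choose 0)) =
      4 * real (Suc n) * (\<Sum>k\<le>n. of_int (gen_euler_T n (int k)) * real (k choose 0))"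
    unfolding sum_gen_euler_T_Suc sum_distrib_left by (intro sum.cong) (simp_all add: algebra_simps)
  show "(\<Sum>k\<le>Suc n. of_int (gen_euler_T (Suc n) (int k)) * real (k choose Suc i)) =
      (4 * real n - 4 * real i) * (\<Sum>k\<le>n. of_int (gen_euler_T n (int k)) * real (k choose Suc i)) +
      (4 * (real n - real i) + 1) * (\<Sum>k\<le>n. of_int (gen_euler_T n (int k)) * real (k choose i))"
    unfolding sum_gen_euler_T_Suc sum_distrib_left sum.distrib[symmetric]
  proof (intro sum.cong refl)
    fix k
    have "(4 * (real n - real k) + 1) * real (Suc k choose Suc i) + (4 * real k + 3) * real (k choose Suc i) =
        (4 * real n + 4) * real (k choose Suc i) + (4 * real n + 1) * real (k choose i)
          - 4 * (real k * real (k choose i))"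
      by (simp add: algebra_simps)
    also have "\<dots> = (4 * real n - 4 * real i) * real (k choose Suc i) + (4 * (real n - real i) + 1) * real (k choose i)"
      unfolding real_mult_binomial by (simp add: algebra_simps)
    finally have eq: "(4 * (real n - real k) + 1) * real (Suc k choose Suc i) + (4 * real k + 3) * real (k choose Suc i) = \<dots>" .
    show "of_int (gen_euler_T n (int k)) *
        ((4 * (real n - real k) + 1) * real (Suc k choose Suc i) + (4 * real k + 3) * real (k choose Suc i)) =
        (4 * real n - 4 * real i) * (of_int (gen_euler_T n (int k)) * real (k choose Suc i)) +
        (4 * (real n - real i) + 1) * (of_int (gen_euler_T n (int k)) * real (k choose i))"
      unfolding eq by (simp add: algebra_simps)
  qed
qed simp

lemma sum_gen_euler_T_binomial_diff:
  assumes "i \<le> n"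
  shows "(\<Sum>k\<le>n. of_int (gen_euler_T n (int k)) * real ((n - k) choose i)) =
    (-1) ^ (n - i) * (fdiff ^^ (n - i)) (\<lambda>j. (3 + 4 * real j) ^ n) 0"
  using _ _ _ assms
proof (rule type_B_worpitzky_recurrence_unique)
  fix n i
  show "(\<Sum>k\<le>Suc n. of_int (gen_euler_T (Suc n) (int k)) * real ((Suc n - k) choose 0)) =
      4 * real (Suc n) * (\<Sum>k\<le>n. of_int (gen_euler_T n (int k)) * real ((n - k) choose 0))"
    unfolding sum_gen_euler_T_Suc sum_distrib_left by (intro sum.cong) (simp_all add: algebra_simps)
  show "(\<Sum>k\<le>Suc n. of_int (gen_euler_T (Suc n) (int k)) * real ((Suc n - k) choose Suc i)) =
      (4 * real n - 4 * real i) * (\<Sum>k\<le>n. of_int (gen_euler_T n (int k)) * real ((n - k) choose Suc i)) +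
      (4 * (real n - real i) + 3) * (\<Sum>k\<le>n. of_int (gen_euler_T n (int k)) * real ((n - k) choose i))"
    unfolding sum_gen_euler_T_Suc sum_distrib_left sum.distrib[symmetric]
  proof (intro sum.cong refl)
    fix k assume "k \<in> {..n}"
    define m where "m = n - k"
    have m: "Suc n - Suc k = m" "Suc n - k = Suc m" "real n - real k = real m" "real k = real n - real m"
      using \<open>k \<in> {..n}\<close> by (auto simp: m_def)
    have "(4 * real m + 1) * real (m choose Suc i) + (4 * (real n - real m) + 3) * real (Suc m choose Suc i) =
        (4 * real n + 4) * real (m choose Suc i) + (4 * real n + 3) * real (m choose i)
          - 4 * (real m * real (m choose i))"
      by (simp add: algebra_simps)
    also have "\<dots> = (4 * real n - 4 * real i) * real (m choose Suc i) + (4 * (real n - real i) + 3) * real (m choose i)"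
      unfolding real_mult_binomial by (simp add: algebra_simps)
    finally have eq: "(4 * real m + 1) * real (m choose Suc i) + (4 * (real n - real m) + 3) * real (Suc m choose Suc i) = \<dots>" .
    show "of_int (gen_euler_T n (int k)) * ((4 * (real n - real k) + 1) * real ((Suc n - Suc k) choose Suc i)
          + (4 * real k + 3) * real ((Suc n - k) choose Suc i)) =
        (4 * real n - 4 * real i) * (of_int (gen_euler_T n (int k)) * real ((n - k) choose Suc i)) +
        (4 * (real n - real i) + 3) * (of_int (gen_euler_T n (int k)) * real ((n - k) choose i))"
      unfolding m(1-3) m_def[symmetric] unfolding m(4) eq by (simp add: algebra_simps)
  qed
qed simp

lemma P_poly_scaled:
  "4 ^ n * P_poly (Suc n) (Suc r) (1 - p / 4) = (-1) ^ n * (fdiff ^^ r) (\<lambda>j. (p + 4 * real j) ^ n) 0"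
proof -
  have "(\<lambda>j. (p + 4 * real j) ^ n) = (\<lambda>j. 4 ^ n * ((1 - (1 - p / 4)) + 1 * real j) ^ n)"
    by (intro ext) (simp add: field_simps flip: power_mult_distrib)
  then show ?thesis
    unfolding P_poly_Suc_Suc by (simp only: fdiff_pow_cmult mult.left_commute)
qed

text \<open>Common form of the two halves of \<open>S_sum\<close>: \<open>\<kappa> k\<close> is \<open>n - k\<close> at \<open>x = 1/4\<close> and \<open>k\<close> at \<open>x = 3/4\<close>.\<close>

lemma sum_gen_log_gamma_real:
  assumes Gam: "multiple_gamma_functions Gam" and "x > 0" and \<kappa>: "\<And>k. k \<le> n \<Longrightarrow> \<kappa> k \<le> n"
    and A: "\<And>i. i \<le> n \<Longrightarrow> (\<Sum>k\<le>n. t k * real (\<kappa> k choose i)) =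
      (-1) ^ (n - i) * (fdiff ^^ (n - i)) (\<lambda>j. (4 * (1 - x) + 4 * real j) ^ n) 0"
  shows "(\<Sum>k\<le>n. t k * log_gamma_real Gam (Suc n) (x + real (\<kappa> k))) = 4 ^ n * gamma_combination Gam n x"
proof -
  let ?g = "\<lambda>i. log_gamma_real Gam (Suc n - i) x"
  have four: "(4 :: real) \<noteq> 0" by simp
  have shift: "log_gamma_real Gam (Suc n) (x + real (\<kappa> k)) = (\<Sum>i\<le>n. (-1) ^ i * real (\<kappa> k choose i) * ?g i)"
    if "k \<le> n" for k
  proof -
    have "log_gamma_real Gam (Suc n) (x + real (\<kappa> k)) = (\<Sum>i\<le>\<kappa> k. (-1) ^ i * real (\<kappa> k choose i) * ?g i)"
      using log_gamma_real_plus_nat[OF Gam \<open>x > 0\<close>, of 0 "\<kappa> k" "Suc n"] \<kappa>[OF that]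
      by (simp add: fdiff_pow_binomial)
    also have "\<dots> = (\<Sum>i\<le>n. (-1) ^ i * real (\<kappa> k choose i) * ?g i)"
      using \<kappa>[OF that] by (intro sum.mono_neutral_left) (auto simp: binomial_eq_0)
    finally show ?thesis .
  qed
  have "(\<Sum>k\<le>n. t k * log_gamma_real Gam (Suc n) (x + real (\<kappa> k))) =
      (\<Sum>k\<le>n. \<Sum>i\<le>n. (-1) ^ i * ?g i * (t k * real (\<kappa> k choose i)))"
    by (intro sum.cong) (simp_all add: shift sum_distrib_left mult_ac)
  also have "\<dots> = (\<Sum>i\<le>n. (-1) ^ i * ?g i * (\<Sum>k\<le>n. t k * real (\<kappa> k choose i)))"
    unfolding sum_distrib_left by (rule sum.swap)
  also have "\<dots> = (\<Sum>i\<le>n. 4 ^ n * P_poly (Suc n) (Suc (n - i)) x * ?g i)"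
  proof (intro sum.cong refl)
    fix i assume "i \<in> {..n}"
    then have sign: "(-1) ^ i * (-1) ^ (n - i) = ((-1) ^ n :: real)" by (simp flip: power_add)
    have "(-1) ^ i * ?g i * (\<Sum>k\<le>n. t k * real (\<kappa> k choose i)) =
        ((-1) ^ i * (-1) ^ (n - i)) * (fdiff ^^ (n - i)) (\<lambda>j. (4 * (1 - x) + 4 * real j) ^ n) 0 * ?g i"
      using A[of i] \<open>i \<in> {..n}\<close> by (simp add: mult_ac)
    also have "\<dots> = 4 ^ n * P_poly (Suc n) (Suc (n - i)) x * ?g i"
      unfolding sign P_poly_scaled[of n _ "4 * (1 - x)", symmetric] nonzero_mult_div_cancel_left[OF four]
      by simp
    finally show "(-1) ^ i * ?g i * (\<Sum>k\<le>n. t k * real (\<kappa> k choose i)) = \<dots>" .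
  qed
  also have "\<dots> = (\<Sum>r\<le>n. 4 ^ n * P_poly (Suc n) (Suc r) x * log_gamma_real Gam (Suc r) x)"
    by (rule sum.reindex_bij_witness[of _ "\<lambda>i. n - i" "\<lambda>i. n - i"]) (auto simp: Suc_diff_le)
  finally show ?thesis by (simp add: gamma_combination_def sum_distrib_left mult.assoc)
qed

theorem S_sum_eq_D_sum:
  assumes "multiple_gamma_functions Gam"
  shows "S_sum Gam n = D_sum Gam n"
proof -
  let ?T = "\<lambda>k. real_of_int (gen_euler_T n (int k))"
  have args: "(4 * (real n - real k) + 1) / 4 = 1/4 + real (n - k)" "(4 * real k + 3) / 4 = 3/4 + real k"
    if "k \<le> n" for k
    using that by (simp_all add: of_nat_diff field_simps)
  have "S_sum Gam n = (\<Sum>k\<le>n. ?T k * log_gamma_real Gam (Suc n) (1/4 + real (n - k))) -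
      (\<Sum>k\<le>n. ?T k * log_gamma_real Gam (Suc n) (3/4 + real k))"
    unfolding S_sum_def atMost_atLeast0[symmetric] sum_subtractf[symmetric]
    by (intro sum.cong refl) (simp only: args atMost_iff right_diff_distrib[of "?T _"] Suc_eq_plus1)
  also have "(\<Sum>k\<le>n. ?T k * log_gamma_real Gam (Suc n) (1/4 + real (n - k))) =
      4 ^ n * gamma_combination Gam n (1/4)"
    by (rule sum_gen_log_gamma_real[OF assms]) (simp_all add: sum_gen_euler_T_binomial_diff)
  also have "(\<Sum>k\<le>n. ?T k * log_gamma_real Gam (Suc n) (3/4 + real k)) =
      4 ^ n * gamma_combination Gam n (3/4)"
    by (rule sum_gen_log_gamma_real[OF assms]) (simp_all add: sum_gen_euler_T_binomial)
  finally show ?thesis by (simp add: D_sum_eq right_diff_distrib)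
qed

theorem theorem6p1:
  fixes Gam :: "nat \<Rightarrow> complex \<Rightarrow> complex" and n :: nat
  assumes "multiple_gamma_functions Gam"
    and "n \<ge> 1"
  shows "S_sum Gam n = D_sum Gam n \<and>
         complex_of_real (D_sum Gam n) =
           deriv dirichlet_beta (- of_nat n)
           + complex_of_real (ln 4) * dirichlet_beta (- of_nat n)"
  using S_sum_eq_D_sum[OF assms(1)] D_sum_eq_beta[OF assms(1)] by simp

end
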